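(* Let $n\ge 1$, let $\Omega\subset\mathbb R^n$ be an open set and let $1<p<\infty$. For $x\in\Omega$ write $d_\Omega(x)=\operatorname{dist}(x,\partial\Omega)$. Suppose that there exist an exponent $0\le\lambda\le n-1$ and a constant $C_0>0$ such that \[ \mathcal H^\lambda_\infty\big(\partial\Omega\cap B(x,2d_\Omega(x))\big)\ge C_0\, d_\Omega(x)^\lambda\quad\text{for all }x\in\Omega . \] Then for every $\beta<p-n+\lambda$ there is a constant $C>0$ such that \[ \int_\Omega |u(x)|^p\, d_\Omega(x)^{\beta-p}\,dx\le C\int_\Omega |\nabla u(x)|^p\, d_\Omega(x)^{\beta}\,dx\quad\text{for every }u\in C_0^\infty(\Omega). \]
   Context: $B(x,r)$ denotes the open Euclidean ball. For $A\subset\mathbb R^n$ and $\lambda\ge0$, the $\lambda$-Hausdorff content is $\mathcal H^\lambda_\infty(A)=\inf\{\sum_{k=1}^\infty r_k^\lambda : A\subset\bigcup_{k=1}^\infty B(x_k,r_k),\ x_k\in A\}$. *)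

theory Defs
  imports "HOL-Analysis.Analysis"
begin

text \<open>lambda-Hausdorff content: infimum of sums of r_k powr lambda over countable
  covers of A by open balls B(x_k, r_k) with centres x_k in A.  Radii r_k are
  nonnegative (a ball of radius 0 is empty and contributes 0 powr lambda = 0, so
  finite covers are included).  Values in ennreal (infinite sums allowed).\<close>
definition hausdorff_content :: "real \<Rightarrow> 'a::euclidean_space set \<Rightarrow> ennreal" where
  "hausdorff_content lam A =
     (INF cr \<in> {(c, r). (\<forall>k::nat. c k \<in> A) \<and> (\<forall>k. 0 \<le> r k) \<and>
                        A \<subseteq> (\<Union>k. ball (c k) (r k))}.
        (\<Sum>k. ennreal (snd cr k powr lam)))"

fun iter_deriv :: "'a::euclidean_space list \<Rightarrow> ('a \<Rightarrow> real) \<Rightarrow> 'a \<Rightarrow> real" where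
  "iter_deriv [] f = f"
| "iter_deriv (v # vs) f = (\<lambda>x. frechet_derivative (iter_deriv vs f) (at x) v)"

definition smooth_on :: "'a::euclidean_space set \<Rightarrow> ('a \<Rightarrow> real) \<Rightarrow> bool" where
  "smooth_on U f \<longleftrightarrow> (\<forall>vs. iter_deriv vs f differentiable_on U)"

definition test_functions :: "'a::euclidean_space set \<Rightarrow> ('a \<Rightarrow> real) set" where
  "test_functions U = {u. smooth_on U u \<and> compact (closure {x. u x \<noteq> 0})
                            \<and> closure {x. u x \<noteq> 0} \<subseteq> U}"

definition grad :: "('a::euclidean_space \<Rightarrow> real) \<Rightarrow> 'a \<Rightarrow> 'a" where
  "grad u x = (\<Sum>b\<in>Basis. frechet_derivative u (at x) b *\<^sub>R b)"

definition dist_bd :: "'a::euclidean_space set \<Rightarrow> 'a \<Rightarrow> real" where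
  "dist_bd \<Omega> x = infdist x (frontier \<Omega>)"

end

theory Submission
  imports Defs
begin

text \<open>
  The exponent \<open>p\<close> is reduced to \<open>1\<close> by working with \<open>v = |u|\<^sup>p\<close>, whose gradient has norm
  \<open>p |u|\<^bsup>p-1\<^esup> |\<nabla>u|\<close>: the inequality \<open>\<integral> |v| d\<^bsup>-\<gamma>-1\<^esup> \<le> C \<integral> |\<nabla>v| d\<^bsup>-\<gamma>\<^esup>\<close> with
  \<open>\<gamma> = p - 1 - \<beta> > n - 1 - \<lambda>\<close> and Young's inequality give the claim, since the left-hand side is
  finite and half of it can be absorbed.

  For exponent \<open>1\<close>, choose \<open>g\<close> strictly between \<open>n - 1 - \<lambda>\<close> and \<open>\<gamma>\<close>, and fix \<open>x \<in> \<Omega>\<close> with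
  \<open>r = d(x)\<close>. Averaging along segments in \<open>B = B(x, 3r)\<close> bounds \<open>|v(x) - v(w)|\<close> by the Riesz
  potentials of \<open>|\<nabla>v| 1\<^sub>B\<close> at \<open>x\<close> and \<open>w\<close>, and \<open>v(w) = 0\<close> for boundary points \<open>w\<close>. By the Vitali
  covering lemma the content condition yields a boundary point \<open>w\<close> in \<open>B(x, 2r)\<close> at which the measure
  \<open>\<mu> = |\<nabla>v| d\<^bsup>-g\<^esup> 1\<^sub>B\<close> satisfies \<open>\<mu>(B(w, s)) \<le> C \<mu>(B) (s/r)\<^sup>\<lambda>\<close> for all \<open>s \<le> 5r\<close>; as \<open>d(y) \<le> |y - w|\<close>,
  this controls the potential at \<open>w\<close> by \<open>r\<^bsup>g+1-n\<^esup> \<mu>(B)\<close>. Integrating the resulting pointwise bound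
  over \<open>x\<close> and exchanging the integrals, the gap between \<open>g\<close> and \<open>\<gamma>\<close> makes the kernel integrable.
\<close>

section \<open>Hausdorff content and potentials\<close>

lemma hausdorff_content_le_countable_cover:
  fixes c :: "'i \<Rightarrow> 'a::euclidean_space"
  assumes "countable I" "c ` I \<subseteq> E" "\<And>i. i \<in> I \<Longrightarrow> 0 \<le> r i"
    and "E \<subseteq> (\<Union>i\<in>I. ball (c i) (r i))" "E \<noteq> {}"
  shows "hausdorff_content lam E \<le> (\<integral>\<^sup>+i. ennreal (r i powr lam) \<partial>count_space I)"
proof -
  obtain a where a: "a \<in> E" using assms(5) by blast
  define J where "J = to_nat_on I ` I"
  define c' where "c' k = (if k \<in> J then c (from_nat_into I k) else a)" for k
  define r' where "r' k = (if k \<in> J then r (from_nat_into I k) else 0)" for k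
  have inv: "from_nat_into I (to_nat_on I i) = i" if "i \<in> I" for i
    using that assms(1) by simp
  have mem: "from_nat_into I k \<in> I" if "k \<in> J" for k
    using that inv by (auto simp: J_def)
  have "(c', r') \<in> {(c, r). (\<forall>k::nat. c k \<in> E) \<and> (\<forall>k. 0 \<le> r k) \<and> E \<subseteq> (\<Union>k. ball (c k) (r k))}"
  proof (clarsimp, intro conjI allI subsetI)
    show "c' k \<in> E" for k using a mem assms(2) by (auto simp: c'_def)
    show "0 \<le> r' k" for k using mem assms(3) by (auto simp: r'_def)
    fix x assume "x \<in> E"
    then obtain i where i: "i \<in> I" "x \<in> ball (c i) (r i)" using assms(4) by blast
    then have "x \<in> ball (c' (to_nat_on I i)) (r' (to_nat_on I i))"
      using inv by (auto simp: c'_def r'_def J_def)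
    then show "x \<in> (\<Union>k. ball (c' k) (r' k))" by blast
  qed
  then have "hausdorff_content lam E \<le> (\<Sum>k. ennreal (snd (c', r') k powr lam))"
    unfolding hausdorff_content_def by (rule INF_lower)
  also have "\<dots> = (\<integral>\<^sup>+k. ennreal (r' k powr lam) \<partial>count_space UNIV)"
    by (simp add: nn_integral_count_space_nat)
  also have "\<dots> = (\<integral>\<^sup>+k. ennreal (r (from_nat_into I k) powr lam) * indicator J k \<partial>count_space UNIV)"
    by (intro nn_integral_cong) (auto simp: r'_def)
  also have "\<dots> = (\<integral>\<^sup>+k. ennreal (r (from_nat_into I k) powr lam) \<partial>count_space J)"
    by (simp add: nn_integral_count_space_indicator)
  also have "\<dots> = (\<integral>\<^sup>+i. ennreal (r (from_nat_into I (to_nat_on I i)) powr lam) \<partial>count_space I)"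
    by (rule nn_integral_bij_count_space[symmetric])
      (simp add: J_def assms(1) bij_betw_def inj_on_to_nat_on)
  also have "\<dots> = (\<integral>\<^sup>+i. ennreal (r i powr lam) \<partial>count_space I)"
    by (intro nn_integral_cong) (simp add: inv)
  finally show ?thesis .
qed

text \<open>If every point of \<open>E\<close> had a ball of too large mass, Vitali's lemma would
  select disjoint ones among them whose fivefold enlargements cover \<open>E\<close>. Disjointness
  bounds the sum of their r^lam from above, while the enlarged cover and the content bound it from
  below, and the two bounds conflict.\<close>

lemma exists_point_of_controlled_growth:
  fixes E :: "'a::euclidean_space set"
  assumes N: "sets N = sets borel" and m: "emeasure N UNIV = ennreal m" "0 \<le> m"
    and H: "0 < H" "ennreal H \<le> hausdorff_content lam E" and E: "E \<noteq> {}"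
  shows "\<exists>w\<in>E. \<forall>s. 0 < s \<and> s \<le> S \<longrightarrow>
           emeasure N (ball w s) \<le> ennreal (2 * 5 powr lam * m / H * s powr lam)"
proof (rule ccontr)
  \<comment> \<open>The factor 5^lam pays for the Vitali enlargement; the factor 2 makes the final
    comparison H <= H/2 a contradiction.\<close>
  define A where "A = 2 * 5 powr lam * m / H"
  assume "\<not> ?thesis"
  then have "\<forall>w\<in>E. \<exists>s. 0 < s \<and> s \<le> S \<and> ennreal (A * s powr lam) < emeasure N (ball w s)"
    by (auto simp: not_le A_def)
  then obtain r where r: "\<And>w. w \<in> E \<Longrightarrow> 0 < r w \<and> r w \<le> S"
    and big: "\<And>w. w \<in> E \<Longrightarrow> ennreal (A * r w powr lam) < emeasure N (ball w (r w))"
    by metis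
  have ball_le: "emeasure N X \<le> ennreal m" for X
    using emeasure_space[of N X] m sets_eq_imp_space_eq[OF N] by simp
  \<comment> \<open>With zero mass the strict inequality \<open>big\<close> already fails.
    Positivity of \<open>m\<close> gives A > 0, so that one may divide by \<open>A\<close>.\<close>
  have "m > 0"
  proof (rule ccontr)
    assume "\<not> m > 0"
    then have "emeasure N (ball w (r w)) = 0" for w
      using ball_le[of "ball w (r w)"] m(2) by simp
    then show False using big E by force
  qed
  then have A: "A > 0" using H by (simp add: A_def)
  obtain I where I: "countable I" "I \<subseteq> E"
    "pairwise (\<lambda>i j. disjnt (ball i (r i)) (ball j (r j))) I"
    "E \<subseteq> (\<Union>i\<in>I. ball i (5 * r i))"
  proof (rule Vitali_covering_lemma_balls[where S=E and K=E and a="\<lambda>x. x" and r=r and B=S])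
    show "E \<subseteq> (\<Union>i\<in>E. ball i (r i))" using r by auto
  qed (use r in blast)+
  have "(\<integral>\<^sup>+i. ennreal (A * r i powr lam) \<partial>count_space I)
      \<le> (\<integral>\<^sup>+i. emeasure N (ball i (r i)) \<partial>count_space I)"
    using big I(2) by (intro nn_integral_mono) (auto intro: less_imp_le)
  also have "\<dots> = emeasure N (\<Union>i\<in>I. ball i (r i))"
    using I(1,3) by (intro emeasure_UN_countable[symmetric])
      (auto simp: N disjoint_family_on_def pairwise_def disjnt_def)
  also have "\<dots> \<le> ennreal m" by (rule ball_le)
  finally have le: "(\<integral>\<^sup>+i. ennreal (A * r i powr lam) \<partial>count_space I) \<le> ennreal m" .
  have "ennreal H \<le> (\<integral>\<^sup>+i. ennreal ((5 * r i) powr lam) \<partial>count_space I)"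
  proof (rule order_trans[OF H(2) hausdorff_content_le_countable_cover])
    show "0 \<le> 5 * r i" if "i \<in> I" for i using that I(2) r by (simp add: less_imp_le subset_iff)
  qed (use I E in auto)
  also have "\<dots> = (\<integral>\<^sup>+i. ennreal (5 powr lam / A) * ennreal (A * r i powr lam) \<partial>count_space I)"
    using A I(2) r by (intro nn_integral_cong)
      (auto simp: ennreal_mult'[symmetric] powr_mult less_imp_le subset_iff)
  also have "\<dots> = ennreal (5 powr lam / A) * (\<integral>\<^sup>+i. ennreal (A * r i powr lam) \<partial>count_space I)"
    by (rule nn_integral_cmult) simp
  also have "\<dots> \<le> ennreal (5 powr lam / A) * ennreal m"
    using le by (rule mult_left_mono) simp
  also have "\<dots> = ennreal (H / 2)"
    using A \<open>m > 0\<close> H by (simp add: ennreal_mult'[symmetric] A_def)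
  finally show False using H by simp
qed

section \<open>Dyadic estimates for potentials and kernels\<close>

lemma ball_in_sets_borel [measurable]: "ball (x::'a::metric_space) r \<in> sets borel"
  by simp

text \<open>The denominator comes from the geometric series over dyadic radii. The maximum is the
  loss in comparing |w - y|^(delta - lam) on an annulus with its value at the outer radius, where
  the exponent may have either sign.\<close>

definition potential_const :: "real \<Rightarrow> real \<Rightarrow> real" where
  "potential_const \<delta> lam = max 1 (2 powr (lam - \<delta>)) / (1 - 2 powr (- \<delta>))"

lemma potential_const_pos: "0 < \<delta> \<Longrightarrow> 0 < potential_const \<delta> lam"
  by (auto simp: potential_const_def powr_less_one intro!: divide_pos_pos)

lemma dyadic_annulus:
  fixes d S :: real
  assumes "0 < d" "d < S"
  shows "\<exists>k::nat. S / 2 ^ Suc k \<le> d \<and> d < S / 2 ^ k"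
proof -
  have ex: "\<exists>k::nat. S / 2 ^ k \<le> d"
  proof -
    obtain k :: nat where "S / d < 2 ^ k" using real_arch_pow[of 2 "S/d"] by auto
    then show ?thesis using assms by (intro exI[of _ k]) (simp add: field_simps less_imp_le)
  qed
  define j where "j = (LEAST k. S / 2 ^ k \<le> d)"
  have j: "S / 2 ^ j \<le> d" unfolding j_def using ex by (rule LeastI_ex)
  then have "j \<noteq> 0" using assms by (intro notI) simp
  then obtain k where k: "j = Suc k" using not0_implies_Suc by blast
  have "\<not> S / 2 ^ k \<le> d" using not_less_Least[of k "\<lambda>k. S / 2 ^ k \<le> d"] k j_def by simp
  then show ?thesis using j k by (intro exI[of _ k]) (simp add: not_le)
qed

lemma ennreal_le_suminf: "f k \<le> (\<Sum>k. f k :: ennreal)"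
  using sum_le_suminf[of f "{k}"] by simp

lemma suminf_ennreal_geometric:
  fixes q a :: real
  assumes "0 \<le> q" "q < 1" "0 \<le> a"
  shows "(\<Sum>k. ennreal (a * q ^ k)) = ennreal (a / (1 - q))"
proof -
  have "(\<lambda>k. a * q ^ k) sums (a * (1 / (1 - q)))"
    using assms by (intro sums_mult geometric_sums) simp
  then show ?thesis
    using assms by (intro suminf_ennreal_eq) auto
qed

lemma power_powr_swap: "0 < b \<Longrightarrow> (b ^ k) powr e = (b powr e) ^ k" for b :: real
  by (simp add: powr_realpow[symmetric] powr_powr mult.commute)

text \<open>On the annulus s/2 <= |w - y| < s the kernel is at most a constant times s^(delta - lam)
  and the mass at most A s^lam. The dyadic annuli thus contribute a geometric series with terms of
  order A s^delta.\<close>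

lemma powr_potential_le:
  fixes w :: "'a::euclidean_space"
  assumes N: "sets N = sets borel" and "0 \<le> A" "0 < \<delta>" "0 < S"
    and growth: "\<And>s. 0 < s \<Longrightarrow> s \<le> S \<Longrightarrow> emeasure N (ball w s) \<le> ennreal (A * s powr lam)"
  shows "(\<integral>\<^sup>+y. ennreal (dist w y powr (\<delta> - lam)) * indicator (ball w S) y \<partial>N)
           \<le> ennreal (potential_const \<delta> lam * A * S powr \<delta>)"
proof -
  let ?e = "\<delta> - lam" and ?M = "max 1 (2 powr (lam - \<delta>)) :: real"
  define s where "s k = S / 2 ^ k" for k :: nat
  have s: "0 < s k" "s k \<le> S" for k
    using \<open>0 < S\<close> by (auto simp: s_def divide_le_eq self_le_power mult_le_cancel_left1)
  have s_pow: "s k powr \<delta> = S powr \<delta> * (2 powr (-\<delta>)) ^ k" for k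
    using \<open>0 < S\<close>
    by (simp add: s_def powr_divide power_powr_swap powr_minus power_inverse field_simps)
  \<comment> \<open>Replacing each annulus by the full ball only enlarges the sum. The centre y = w
    lies in no annulus, but the kernel vanishes there because \<open>0 powr e = 0\<close>.\<close>
  have pt: "ennreal (dist w y powr ?e) * indicator (ball w S) y
      \<le> (\<Sum>k. ennreal (?M * s k powr ?e) * indicator (ball w (s k)) y)" for y
  proof (cases "y \<in> ball w S \<and> y \<noteq> w")
    case True
    define d where "d = dist w y"
    have d: "0 < d" "d < S" using True by (auto simp: d_def)
    obtain k where k: "s k / 2 \<le> d" "d < s k"
      using dyadic_annulus[OF d] by (auto simp: s_def field_simps)
    have "d powr ?e \<le> ?M * s k powr ?e"
    proof (cases "0 \<le> ?e")
      case True
      then have "d powr ?e \<le> s k powr ?e" using k d by (intro powr_mono2) auto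
      also have "\<dots> \<le> ?M * s k powr ?e" by (simp add: mult_le_cancel_right1)
      finally show ?thesis .
    next
      case False
      then have "d powr ?e \<le> (s k / 2) powr ?e" using k s by (intro powr_mono2') auto
      also have "\<dots> = 2 powr (lam - \<delta>) * s k powr ?e"
        using s[of k] by (simp add: powr_divide powr_diff field_simps)
      also have "\<dots> \<le> ?M * s k powr ?e" by (intro mult_right_mono) auto
      finally show ?thesis .
    qed
    then have "ennreal (dist w y powr ?e) * indicator (ball w S) y
        \<le> ennreal (?M * s k powr ?e) * indicator (ball w (s k)) y"
      using True k by (simp add: d_def ennreal_leI)
    also have "\<dots> \<le> (\<Sum>k. ennreal (?M * s k powr ?e) * indicator (ball w (s k)) y)"
      by (rule ennreal_le_suminf)
    finally show ?thesis .
  qed auto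
  have [measurable]: "ball w t \<in> sets N" for t by (simp add: N)
  have "(\<integral>\<^sup>+y. ennreal (dist w y powr ?e) * indicator (ball w S) y \<partial>N)
      \<le> (\<integral>\<^sup>+y. (\<Sum>k. ennreal (?M * s k powr ?e) * indicator (ball w (s k)) y) \<partial>N)"
    by (intro nn_integral_mono pt)
  also have "\<dots> = (\<Sum>k. ennreal (?M * s k powr ?e) * emeasure N (ball w (s k)))"
    by (subst nn_integral_suminf) (auto simp: nn_integral_cmult_indicator)
  also have "\<dots> \<le> (\<Sum>k. ennreal (?M * s k powr ?e) * ennreal (A * s k powr lam))"
    by (intro suminf_le mult_left_mono growth s) auto
  also have "\<dots> = (\<Sum>k. ennreal (?M * A * S powr \<delta> * (2 powr (-\<delta>)) ^ k))"
  proof -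
    have "?M * s k powr ?e * (A * s k powr lam) = ?M * A * S powr \<delta> * (2 powr (-\<delta>)) ^ k" for k
    proof -
      have "s k powr ?e * s k powr lam = s k powr \<delta>" by (simp add: powr_add[symmetric])
      then show ?thesis by (simp add: s_pow mult_ac)
    qed
    then have "ennreal (?M * s k powr ?e) * ennreal (A * s k powr lam)
        = ennreal (?M * A * S powr \<delta> * (2 powr (-\<delta>)) ^ k)" for k
      using \<open>0 \<le> A\<close> by (subst ennreal_mult''[symmetric]) simp_all
    then show ?thesis by simp
  qed
  also have "\<dots> = ennreal (?M * A * S powr \<delta> / (1 - 2 powr (-\<delta>)))"
    using assms by (intro suminf_ennreal_geometric) (auto simp: powr_less_one)
  finally show ?thesis by (simp add: potential_const_def mult_ac)
qed

lemma dyadic_annulus_outward: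
  fixes d t :: real
  assumes "0 < t" "t \<le> d"
  shows "\<exists>k::nat. 2 ^ k * t \<le> d \<and> d < 2 ^ Suc k * t"
proof -
  have ex: "\<exists>k::nat. d < 2 ^ k * t"
    using real_arch_pow[of 2 "d / t"] assms by (auto simp: field_simps)
  define j where "j = (LEAST k. d < 2 ^ k * t)"
  have j: "d < 2 ^ j * t" unfolding j_def using ex by (rule LeastI_ex)
  then have "j \<noteq> 0" using assms by (intro notI) simp
  then obtain k where k: "j = Suc k" using not0_implies_Suc by blast
  have "\<not> d < 2 ^ k * t" using not_less_Least[of k "\<lambda>k. d < 2 ^ k * t"] k j_def by simp
  then show ?thesis using j k by (intro exI[of _ k]) (simp add: not_less)
qed

text \<open>Lebesgue measure has growth exponent n, so the potential estimate applies with lam = n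
  and delta = 1.\<close>

lemma riesz_kernel_ball_le:
  fixes y :: "'a::euclidean_space"
  assumes "0 < S"
  shows "(\<integral>\<^sup>+x. ennreal (dist y x powr (1 - real DIM('a))) * indicator (ball y S) x \<partial>lborel)
     \<le> ennreal (potential_const 1 DIM('a) * unit_ball_vol DIM('a) * S)"
proof -
  have "(\<integral>\<^sup>+x. ennreal (dist y x powr (1 - real DIM('a))) * indicator (ball y S) x \<partial>lborel)
     \<le> ennreal (potential_const 1 DIM('a) * unit_ball_vol DIM('a) * S powr 1)"
    using assms by (intro powr_potential_le) (auto simp: emeasure_ball powr_realpow)
  then show ?thesis using assms by simp
qed

text \<open>The kernel is integrable near y and decays like |x - y|^(-n - eps) far away. Dyadic
  shells of |x - y| + t, starting at scale t, treat both ranges at once: scale s contributes s^(-1 -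
  eps) times s, and these terms sum to a multiple of t^(-eps). The bound serves with t = d(y) once
  the integrals are exchanged.\<close>

lemma riesz_kernel_decay_integral_le:
  assumes "0 < \<epsilon>"
  shows "\<exists>C>0. \<forall>(y::'a::euclidean_space) t. 0 < t \<longrightarrow>
    (\<integral>\<^sup>+x. ennreal (dist y x powr (1 - real DIM('a)) * (dist y x + t) powr (- 1 - \<epsilon>)) \<partial>lborel)
      \<le> ennreal (C * t powr (- \<epsilon>))"
proof -
  define P where "P = potential_const 1 DIM('a) * unit_ball_vol DIM('a)"
  have P: "0 < P" by (simp add: P_def potential_const_pos)
  define C where "C = 2 * P / (1 - 2 powr (- \<epsilon>))"
  have q: "2 powr (- \<epsilon>) < 1" using assms by (simp add: powr_less_one)
  have C: "0 < C" using P q by (simp add: C_def)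
  have "(\<integral>\<^sup>+x. ennreal (dist y x powr (1 - real DIM('a)) * (dist y x + t) powr (- 1 - \<epsilon>)) \<partial>lborel)
      \<le> ennreal (C * t powr (- \<epsilon>))" if t: "0 < t" for y :: 'a and t
  proof -
    let ?K = "\<lambda>x. ennreal (dist y x powr (1 - real DIM('a)))"
    define s where "s k = 2 ^ k * t" for k :: nat
    have s: "0 < s k" for k using t by (simp add: s_def)
    have meas: "(\<lambda>x. ?K x * indicator (ball y (2 * s k)) x) \<in> borel_measurable lborel" for k
      by measurable
    have pt: "ennreal (dist y x powr (1 - real DIM('a)) * (dist y x + t) powr (- 1 - \<epsilon>))
        \<le> (\<Sum>k. ennreal (s k powr (- 1 - \<epsilon>)) * (?K x * indicator (ball y (2 * s k)) x))" for x
    proof -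
      obtain k where k: "s k \<le> dist y x + t" "dist y x + t < 2 * s k"
        using dyadic_annulus_outward[OF t, of "dist y x + t"] by (auto simp: s_def)
      have "(dist y x + t) powr (- 1 - \<epsilon>) \<le> s k powr (- 1 - \<epsilon>)"
        using k s assms by (intro powr_mono2') auto
      then have "ennreal (dist y x powr (1 - real DIM('a)) * (dist y x + t) powr (- 1 - \<epsilon>))
          \<le> ennreal (dist y x powr (1 - real DIM('a)) * s k powr (- 1 - \<epsilon>))"
        by (intro ennreal_leI mult_left_mono) auto
      also have "\<dots> = ennreal (s k powr (- 1 - \<epsilon>)) * (?K x * indicator (ball y (2 * s k)) x)"
        using k t by (simp add: ennreal_mult' mult.commute)
      also have "\<dots> \<le> (\<Sum>k. ennreal (s k powr (- 1 - \<epsilon>)) * (?K x * indicator (ball y (2 * s k)) x))"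
        by (rule ennreal_le_suminf)
      finally show ?thesis .
    qed
    have "(\<integral>\<^sup>+x. ennreal (dist y x powr (1 - real DIM('a)) * (dist y x + t) powr (- 1 - \<epsilon>)) \<partial>lborel)
      \<le> (\<integral>\<^sup>+x. (\<Sum>k. ennreal (s k powr (- 1 - \<epsilon>)) * (?K x * indicator (ball y (2 * s k)) x)) \<partial>lborel)"
      by (intro nn_integral_mono pt)
    also have "\<dots> = (\<Sum>k. ennreal (s k powr (- 1 - \<epsilon>))
        * (\<integral>\<^sup>+x. ?K x * indicator (ball y (2 * s k)) x \<partial>lborel))"
      by (simp only: nn_integral_suminf nn_integral_cmult meas borel_measurable_const borel_measurable_times_ennreal)
    also have "\<dots> \<le> (\<Sum>k. ennreal (s k powr (- 1 - \<epsilon>)) * ennreal (P * (2 * s k)))"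
      unfolding P_def using s by (intro suminf_le mult_left_mono riesz_kernel_ball_le) auto
    also have "\<dots> = (\<Sum>k. ennreal (2 * P * t powr (- \<epsilon>) * (2 powr (- \<epsilon>)) ^ k))"
    proof -
      have "s k powr (- 1 - \<epsilon>) * (P * (2 * s k)) = 2 * P * t powr (- \<epsilon>) * (2 powr (- \<epsilon>)) ^ k" for k
      proof -
        have "s k powr (- 1 - \<epsilon>) * s k = s k powr (- 1 - \<epsilon>) * s k powr 1"
          using s[of k] by simp
        also have "\<dots> = s k powr (- \<epsilon>)" by (subst powr_add[symmetric]) simp
        also have "\<dots> = t powr (- \<epsilon>) * (2 powr (- \<epsilon>)) ^ k"
          using t by (simp add: s_def powr_mult power_powr_swap)
        finally show ?thesis by (simp add: mult_ac)
      qed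
      then show ?thesis by (simp only: ennreal_mult'[symmetric, OF powr_ge_zero])
    qed
    also have "\<dots> = ennreal (2 * P * t powr (- \<epsilon>) / (1 - 2 powr (- \<epsilon>)))"
      using P q by (intro suminf_ennreal_geometric) auto
    finally show ?thesis by (simp add: C_def mult_ac)
  qed
  with C show ?thesis by blast
qed

section \<open>Mean oscillation over a ball\<close>

lemma nn_integral_lborel_affine:
  fixes h :: "'a::euclidean_space \<Rightarrow> ennreal"
  assumes [measurable]: "h \<in> borel_measurable borel" and "c \<noteq> 0"
  shows "(\<integral>\<^sup>+y. h y \<partial>lborel) = ennreal (\<bar>c\<bar> ^ DIM('a)) * (\<integral>\<^sup>+z. h (a + c *\<^sub>R z) \<partial>lborel)"
  by (subst lborel_affine[OF assms(2), of a])
    (simp add: nn_integral_density nn_integral_distr nn_integral_cmult ennreal_power)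

text \<open>The exponent n + 1 is the one produced by y = w + t(z - w): the Jacobian gives t^(-n),
  and |z - w| = |y - w| / t gives one more factor.\<close>

lemma nn_integral_inverse_power:
  fixes a :: real
  assumes "0 < a" "0 < n"
  shows "(\<integral>\<^sup>+t. ennreal (1 / t ^ (n + 1)) * indicator {a..} t \<partial>lborel) = ennreal (1 / (real n * a ^ n))"
proof -
  have "(\<integral>\<^sup>+t. ennreal (1 / t ^ (n + 1)) * indicator {a..} t \<partial>lborel)
      = ennreal (0 - (- (1 / (real n * a ^ n))))"
  proof (rule nn_integral_FTC_atLeast)
    show "((\<lambda>t. - (1 / (real n * t ^ n))) has_real_derivative 1 / t ^ (n + 1)) (at t)" if "a \<le> t" for t
      using that assms
      by (auto intro!: derivative_eq_intros simp: field_simps power2_eq_square)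
         (cases n; simp add: field_simps)
    have "((\<lambda>t::real. inverse (real n) * inverse (t ^ n)) \<longlongrightarrow> inverse (real n) * 0) at_top"
      using assms by (intro tendsto_mult tendsto_const tendsto_inverse_0_at_top filterlim_pow_at_top filterlim_ident) auto
    then show "((\<lambda>t. - (1 / (real n * t ^ n))) \<longlongrightarrow> 0) at_top"
      using tendsto_minus by (fastforce simp: field_simps)
  qed (use assms in auto)
  then show ?thesis by simp
qed

text \<open>Substituting \<open>y = w + t(z - w)\<close> turns the mean over \<open>z\<close> of the segment integrals
  into a Riesz potential, because the segment parameter is forced to exceed \<open>|y - w| / 2R\<close>.\<close>
lemma mean_oscillation_le_riesz_potential:
  fixes v G :: "'a::euclidean_space \<Rightarrow> real"
  assumes G[measurable]: "G \<in> borel_measurable borel" and G0: "\<And>y. 0 \<le> G y"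
    and ug: "\<And>z w. ennreal \<bar>v z - v w\<bar> \<le>
      (\<integral>\<^sup>+t. ennreal (G (w + t *\<^sub>R (z - w)) * norm (z - w)) * indicator {0<..1} t \<partial>lborel)"
    and w: "w \<in> ball x R"
  shows "(\<integral>\<^sup>+z. ennreal \<bar>v z - v w\<bar> * indicator (ball x R) z \<partial>lborel)
    \<le> ennreal ((2 * R) ^ DIM('a) / DIM('a)) *
       (\<integral>\<^sup>+y. ennreal (G y * dist w y powr (1 - real DIM('a))) * indicator (ball x R) y \<partial>lborel)"
proof -
  let ?n = "DIM('a)"
  have R: "0 < R" using w by (auto intro: le_less_trans[OF zero_le_dist])
  \<comment> \<open>The condition |y - w| < 2 R t is what remains of z lying in the ball, where |z -
    w| < 2R. That y lies in the ball as well is due to convexity.\<close>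
  define F where "F t y = ennreal (G y * dist w y) * indicator (ball x R) y
      * (ennreal (1 / t ^ (?n + 1)) * (if dist w y < 2 * R * t then 1 else 0))" for t y
  have F[measurable]: "case_prod F \<in> borel_measurable (borel \<Otimes>\<^sub>M borel)"
    unfolding F_def case_prod_unfold by measurable
  have sub: "(\<integral>\<^sup>+z. ennreal (G (w + t *\<^sub>R (z - w)) * norm (z - w)) * indicator (ball x R) z \<partial>lborel)
      \<le> (\<integral>\<^sup>+y. F t y \<partial>lborel)" if t: "0 < t" "t \<le> 1" for t
  proof -
    have "(\<integral>\<^sup>+z. ennreal (G (w + t *\<^sub>R (z - w)) * norm (z - w)) * indicator (ball x R) z \<partial>lborel)
      \<le> (\<integral>\<^sup>+z. ennreal (t ^ ?n) * F t ((w - t *\<^sub>R w) + t *\<^sub>R z) \<partial>lborel)"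
    proof (rule nn_integral_mono)
      fix z :: 'a
      define y where "y = w + t *\<^sub>R (z - w)"
      have y: "(w - t *\<^sub>R w) + t *\<^sub>R z = y" by (simp add: y_def algebra_simps)
      have d: "dist w y = t * norm (z - w)" using t by (simp add: y_def dist_norm)
      show "ennreal (G (w + t *\<^sub>R (z - w)) * norm (z - w)) * indicator (ball x R) z
          \<le> ennreal (t ^ ?n) * F t ((w - t *\<^sub>R w) + t *\<^sub>R z)"
      proof (cases "z \<in> ball x R")
        case True
        have "y = (1 - t) *\<^sub>R w + t *\<^sub>R z" by (simp add: y_def algebra_simps)
        then have yB: "y \<in> ball x R"
          using convexD[OF convex_ball w True, of "1 - t" t] t by simp
        have "norm (z - w) < 2 * R"
          using w True dist_triangle[of z w x] by (auto simp: dist_norm norm_minus_commute)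
        then have "dist w y < 2 * R * t" using t d by (simp add: mult.commute)
        then show ?thesis
          using True yB t G0[of y] unfolding y F_def y_def[symmetric] d
          by (auto simp: ennreal_mult'[symmetric])
      qed simp
    qed
    also have "\<dots> = (\<integral>\<^sup>+y. F t y \<partial>lborel)"
      using t by (subst nn_integral_lborel_affine[of _ t "w - t *\<^sub>R w"]) (auto simp: nn_integral_cmult)
    finally show ?thesis .
  qed
  have "(\<integral>\<^sup>+z. ennreal \<bar>v z - v w\<bar> * indicator (ball x R) z \<partial>lborel)
     \<le> (\<integral>\<^sup>+z. (\<integral>\<^sup>+t. ennreal (G (w + t *\<^sub>R (z - w)) * norm (z - w)) * indicator (ball x R) z
           * indicator {0<..1} t \<partial>lborel) \<partial>lborel)"
  proof (rule nn_integral_mono)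
    fix z
    show "ennreal \<bar>v z - v w\<bar> * indicator (ball x R) z
     \<le> (\<integral>\<^sup>+t. ennreal (G (w + t *\<^sub>R (z - w)) * norm (z - w)) * indicator (ball x R) z
           * indicator {0<..1} t \<partial>lborel)"
      using ug[of z w] by (cases "z \<in> ball x R") auto
  qed
  also have "\<dots> = (\<integral>\<^sup>+t. (\<integral>\<^sup>+z. ennreal (G (w + t *\<^sub>R (z - w)) * norm (z - w)) * indicator (ball x R) z
           * indicator {0<..1} t \<partial>lborel) \<partial>lborel)"
    by (rule lborel_pair.Fubini') (simp add: case_prod_unfold)
  also have "\<dots> \<le> (\<integral>\<^sup>+t. (\<integral>\<^sup>+y. F t y * indicator {0<..1} t \<partial>lborel) \<partial>lborel)"
  proof (rule nn_integral_mono)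
    fix t :: real
    show "(\<integral>\<^sup>+z. ennreal (G (w + t *\<^sub>R (z - w)) * norm (z - w)) * indicator (ball x R) z
           * indicator {0<..1} t \<partial>lborel) \<le> (\<integral>\<^sup>+y. F t y * indicator {0<..1} t \<partial>lborel)"
      using sub[of t] by (cases "t \<in> {0<..1}") auto
  qed
  also have "\<dots> = (\<integral>\<^sup>+y. (\<integral>\<^sup>+t. F t y * indicator {0<..1} t \<partial>lborel) \<partial>lborel)"
    by (rule lborel_pair.Fubini') (simp add: case_prod_unfold)
  also have "\<dots> \<le> (\<integral>\<^sup>+y. ennreal ((2 * R) ^ ?n / ?n) *
       (ennreal (G y * dist w y powr (1 - real ?n)) * indicator (ball x R) y) \<partial>lborel)"
  proof (rule nn_integral_mono)
    fix y :: 'a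
    show "(\<integral>\<^sup>+t. F t y * indicator {0<..1} t \<partial>lborel) \<le> ennreal ((2 * R) ^ ?n / ?n) *
       (ennreal (G y * dist w y powr (1 - real ?n)) * indicator (ball x R) y)"
    proof (cases "y = w")
      case False
      define a where "a = dist w y / (2 * R)"
      have a: "0 < a" using False R by (simp add: a_def)
      have "(\<integral>\<^sup>+t. F t y * indicator {0<..1} t \<partial>lborel)
        \<le> (\<integral>\<^sup>+t. (ennreal (G y * dist w y) * indicator (ball x R) y) *
              (ennreal (1 / t ^ (?n + 1)) * indicator {a..} t) \<partial>lborel)"
      proof (rule nn_integral_mono)
        fix t :: real
        have "a \<le> t" if "dist w y < 2 * R * t" using that R by (simp add: a_def field_simps)
        then show "F t y * indicator {0<..1} t \<le> (ennreal (G y * dist w y) * indicator (ball x R) y) *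
              (ennreal (1 / t ^ (?n + 1)) * indicator {a..} t)"
          unfolding F_def by (cases "dist w y < 2 * R * t"; cases "t \<in> {0<..1}") simp_all
      qed
      also have "\<dots> = (ennreal (G y * dist w y) * indicator (ball x R) y) * ennreal (1 / (real ?n * a ^ ?n))"
        by (subst nn_integral_cmult) (auto simp only: nn_integral_inverse_power[OF a DIM_positive], measurable)
      also have "\<dots> = ennreal ((2 * R) ^ ?n / ?n) *
         (ennreal (G y * dist w y powr (1 - real ?n)) * indicator (ball x R) y)"
      proof -
        have "dist w y powr (1 - real ?n) = dist w y / dist w y ^ ?n"
          using False by (simp add: powr_diff powr_realpow)
        then have "G y * dist w y * (1 / (real ?n * a ^ ?n))
            = (2 * R) ^ ?n / ?n * (G y * dist w y powr (1 - real ?n))"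
          using R by (simp add: a_def power_divide field_simps)
        then show ?thesis
          using G0[of y] R by (cases "y \<in> ball x R") (simp_all add: ennreal_mult'[symmetric] del: times_divide_eq_right)
      qed
      finally show ?thesis .
    qed (simp add: F_def)
  qed
  also have "\<dots> = ennreal ((2 * R) ^ ?n / ?n) *
       (\<integral>\<^sup>+y. ennreal (G y * dist w y powr (1 - real ?n)) * indicator (ball x R) y \<partial>lborel)"
    by (rule nn_integral_cmult) simp
  finally show ?thesis .
qed

section \<open>The inequality with exponent one\<close>

text \<open>An upper gradient tested on straight segments only, which is all that the oscillation
  estimate uses and can be verified for |u|^p. The parameter t = 0 is left out because the
  substitution divides by t.\<close>

definition segment_gradient :: "('a::euclidean_space \<Rightarrow> real) \<Rightarrow> ('a \<Rightarrow> real) \<Rightarrow> bool" where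
  "segment_gradient v G \<longleftrightarrow> G \<in> borel_measurable borel \<and> (\<forall>y. 0 \<le> G y) \<and>
     (\<forall>z w. ennreal \<bar>v z - v w\<bar> \<le>
        (\<integral>\<^sup>+t. ennreal (G (w + t *\<^sub>R (z - w)) * norm (z - w)) * indicator {0<..1} t \<partial>lborel))"

section \<open>Distance to the boundary and the pointwise estimate\<close>

lemma dist_bd_pos:
  assumes "open \<Omega>" "frontier \<Omega> \<noteq> {}" "x \<in> \<Omega>"
  shows "0 < dist_bd \<Omega> x"
  unfolding dist_bd_def using assms
  by (intro infdist_pos_not_in_closed) (auto simp: frontier_def interior_open)

lemma dist_bd_le: "dist_bd \<Omega> x \<le> dist_bd \<Omega> y + dist x y"
  unfolding dist_bd_def by (rule infdist_triangle)

lemma dist_bd_le_dist: "w \<in> frontier \<Omega> \<Longrightarrow> dist_bd \<Omega> y \<le> dist w y"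
  unfolding dist_bd_def by (metis dist_commute infdist_le)

lemma continuous_on_dist_bd: "continuous_on A (dist_bd \<Omega>)"
  unfolding dist_bd_def by (intro continuous_intros)

lemma borel_measurable_dist_bd [measurable]: "dist_bd \<Omega> \<in> borel_measurable borel"
  by (intro borel_measurable_continuous_onI continuous_on_dist_bd)

text \<open>With v(w) = 0, the mean over z in \<open>B\<close> of |v(z) - v(x)| + |v(z) - v(w)|
  bounds |v(x)|, and both means are bounded by Riesz potentials of \<open>G\<close>. The weight
  d^(-g) enters through d <= 4r on \<open>B\<close> for the potential at x, and through d(y) <= |y -
  w| for the one at w. Since \<open>K\<close> is uniform in \<open>v\<close>, \<open>G\<close> and
  \<open>x\<close>, the bound can be integrated over x.\<close>

lemma pointwise_hardy:
  fixes \<Omega> :: "'a::euclidean_space set"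
  assumes \<Omega>: "open \<Omega>" "frontier \<Omega> \<noteq> {}" and C0: "0 < C\<^sub>0"
    and dens: "\<forall>x\<in>\<Omega>. ennreal (C\<^sub>0 * dist_bd \<Omega> x powr lam)
        \<le> hausdorff_content lam (frontier \<Omega> \<inter> ball x (2 * dist_bd \<Omega> x))"
    and g: "real DIM('a) - 1 - lam < g" "0 \<le> g"
  shows "\<exists>K>0. \<forall>v G x. v \<in> borel_measurable borel \<longrightarrow> segment_gradient v G
      \<longrightarrow> (\<forall>y. y \<notin> \<Omega> \<longrightarrow> G y = 0) \<longrightarrow> (\<forall>y\<in>frontier \<Omega>. v y = 0) \<longrightarrow> x \<in> \<Omega> \<longrightarrow>
     ennreal \<bar>v x\<bar> \<le> ennreal (K * dist_bd \<Omega> x powr g) *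
       (\<integral>\<^sup>+y. ennreal (dist x y powr (1 - real DIM('a)) * (G y * dist_bd \<Omega> y powr (- g)))
          * indicator (ball x (3 * dist_bd \<Omega> x)) y \<partial>lborel)"
proof -
  let ?n = "DIM('a)"
  define d where "d = dist_bd \<Omega>"
  \<comment> \<open>Chosen so that delta - lam = g + 1 - n, the exponent of the kernel at w after
    d(y)^g has been replaced by |y - w|^g.\<close>
  define \<delta> where "\<delta> = g + 1 - real ?n + lam"
  have \<delta>: "0 < \<delta>" using g by (simp add: \<delta>_def)
  \<comment> \<open>\<open>K\<^sub>2\<close> combines the growth constant, the radius 5r, and the
    factor 3^(n-1) lost in comparing the mass of \<open>N\<close> with \<open>J\<close>.
    \<open>L\<close> is (6r)^n / n divided by the volume of \<open>B\<close>.\<close>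
  define K\<^sub>2 where "K\<^sub>2 = potential_const \<delta> lam * (2 * 5 powr lam / C\<^sub>0) * 5 powr \<delta> * 3 powr (real ?n - 1)"
  define L where "L = 2 ^ ?n / (real ?n * unit_ball_vol ?n)"
  define K where "K = L * (4 powr g + K\<^sub>2)"
  have K2: "0 < K\<^sub>2" using \<delta> C0 by (simp add: K\<^sub>2_def potential_const_pos)
  have L: "0 < L" by (simp add: L_def)
  have K: "0 < K" using L K2 by (simp add: K_def add_pos_pos)
  have d_meas[measurable]: "d \<in> borel_measurable borel" by (simp add: d_def)
  have bound: "ennreal \<bar>v x\<bar> \<le> ennreal (K * d x powr g) *
       (\<integral>\<^sup>+y. ennreal (dist x y powr (1 - real ?n) * (G y * d y powr (- g)))
          * indicator (ball x (3 * d x)) y \<partial>lborel)" (is "_ \<le> _ * ?J")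
    if v[measurable]: "v \<in> borel_measurable borel" and sg: "segment_gradient v G"
      and G_out: "\<And>y. y \<notin> \<Omega> \<Longrightarrow> G y = 0" and v_bd: "\<And>y. y \<in> frontier \<Omega> \<Longrightarrow> v y = 0"
      and x: "x \<in> \<Omega>" for v G x
  proof (cases "?J = \<infinity>")
    \<comment> \<open>An infinite potential makes the bound trivial; in the other case its
      finiteness makes the mass of \<open>N\<close> finite.\<close>
    case True
    have "0 < ennreal (K * d x powr g)"
      using K dist_bd_pos[OF \<Omega> x] by (simp add: d_def ennreal_zero_less_mult_iff)
    then have "ennreal (K * d x powr g) * ?J = top"
      unfolding True infinity_ennreal_def by (metis ennreal_mult_top less_irrefl)
    then show ?thesis by simp
  next
    case False
    have G[measurable]: "G \<in> borel_measurable borel" and G0: "\<And>y. 0 \<le> G y"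
      and ug: "\<And>z w. ennreal \<bar>v z - v w\<bar> \<le>
        (\<integral>\<^sup>+t. ennreal (G (w + t *\<^sub>R (z - w)) * norm (z - w)) * indicator {0<..1} t \<partial>lborel)"
      using sg by (auto simp: segment_gradient_def)
    define r where "r = d x"
    have r: "0 < r" using dist_bd_pos[OF \<Omega> x] by (simp add: r_def d_def)
    define B where "B = ball x (3 * r)"
    have B[measurable]: "B \<in> sets borel" by (simp add: B_def)
    define E where "E = frontier \<Omega> \<inter> ball x (2 * r)"
    define f where "f y = G y * d y powr (- g)" for y
    have f0: "0 \<le> f y" for y using G0 by (simp add: f_def)
    have f[measurable]: "f \<in> borel_measurable borel" unfolding f_def by measurable
    define J where "J = (\<integral>\<^sup>+y. ennreal (dist x y powr (1 - real ?n) * f y) * indicator B y \<partial>lborel)"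
    have J: "J = ?J" by (simp add: J_def f_def B_def r_def)
    have Jfin: "J \<noteq> \<infinity>" using False J by simp
    define N where "N = density lborel (\<lambda>y. ennreal (f y) * indicator B y)"
    have N: "sets N = sets borel" by (simp add: N_def)
    \<comment> \<open>On \<open>B\<close> the kernel |x - y|^(1-n) is at least (3r)^(1-n). The null
      set y = x must be excluded, since \<open>0 powr e = 0\<close>.\<close>
    have mass: "ennreal ((3 * r) powr (1 - real ?n)) * emeasure N UNIV \<le> J"
    proof -
      have "ennreal ((3 * r) powr (1 - real ?n)) * emeasure N UNIV
         = (\<integral>\<^sup>+y. ennreal ((3 * r) powr (1 - real ?n)) * (ennreal (f y) * indicator B y) \<partial>lborel)"
        by (simp add: N_def emeasure_density nn_integral_cmult)
      also have "\<dots> \<le> J" unfolding J_def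
      proof (rule nn_integral_mono_AE)
        show "AE y in lborel. ennreal ((3 * r) powr (1 - real ?n)) * (ennreal (f y) * indicator B y)
          \<le> ennreal (dist x y powr (1 - real ?n) * f y) * indicator B y"
          using AE_lborel_singleton[of x]
        proof eventually_elim
          case (elim y)
          show ?case
          proof (cases "y \<in> B")
            case True
            then have "(3 * r) powr (1 - real ?n) \<le> dist x y powr (1 - real ?n)"
              using elim by (intro powr_mono2') (auto simp: B_def)
            then show ?thesis
              using True f0[of y] by (auto simp: ennreal_mult'[symmetric] intro!: ennreal_leI mult_right_mono)
          qed simp
        qed
      qed
      finally show ?thesis .
    qed
    have "emeasure N UNIV \<noteq> \<infinity>"
    proof
      assume "emeasure N UNIV = \<infinity>"
      then show False using mass Jfin r by (simp add: ennreal_mult_top top_unique)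
    qed
    then obtain m where m: "emeasure N UNIV = ennreal m" "0 \<le> m"
      by (cases "emeasure N UNIV") auto
    have E: "E \<noteq> {}"
    proof -
      obtain w where "w \<in> frontier \<Omega>" "infdist x (frontier \<Omega>) = dist x w"
        using infdist_attains_inf[OF frontier_closed \<Omega>(2)] by blast
      then show ?thesis using r by (auto simp: E_def r_def d_def dist_bd_def)
    qed
    have H: "0 < C\<^sub>0 * r powr lam" "ennreal (C\<^sub>0 * r powr lam) \<le> hausdorff_content lam E"
      using C0 r dens x by (auto simp: E_def r_def d_def)
    define A where "A = 2 * 5 powr lam * m / (C\<^sub>0 * r powr lam)"
    have A: "0 \<le> A" using m C0 by (simp add: A_def)
    \<comment> \<open>The radii go up to 5r because \<open>B\<close> lies in
      \<open>ball w (5 * r)\<close>, by |x - w| < 2r.\<close>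
    obtain w where w: "w \<in> E"
      and growth: "\<And>s. 0 < s \<Longrightarrow> s \<le> 5 * r \<Longrightarrow> emeasure N (ball w s) \<le> ennreal (A * s powr lam)"
      using exists_point_of_controlled_growth[OF N m H E, of "5 * r"] by (auto simp: A_def)
    have wf: "w \<in> frontier \<Omega>" and wB: "w \<in> B" and wx: "dist x w < 2 * r"
      using w r by (auto simp: E_def B_def)
    let ?I = "\<lambda>a. \<integral>\<^sup>+y. ennreal (G y * dist a y powr (1 - real ?n)) * indicator B y \<partial>lborel"
    have Ix: "?I x \<le> ennreal (4 powr g * r powr g) * J"
    proof -
      have "?I x \<le> (\<integral>\<^sup>+y. ennreal (4 powr g * r powr g) *
          (ennreal (dist x y powr (1 - real ?n) * f y) * indicator B y) \<partial>lborel)"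
      proof (rule nn_integral_mono)
        fix y
        show "ennreal (G y * dist x y powr (1 - real ?n)) * indicator B y
          \<le> ennreal (4 powr g * r powr g) * (ennreal (dist x y powr (1 - real ?n) * f y) * indicator B y)"
        proof (cases "y \<in> B \<and> G y \<noteq> 0")
          case True
          then have "y \<in> \<Omega>" using G_out by blast
          then have dy: "0 < d y" using dist_bd_pos[OF \<Omega>] by (simp add: d_def)
          have "d y \<le> 4 * r"
            using dist_bd_le[of \<Omega> y x] True by (simp add: r_def d_def B_def dist_commute)
          then have "d y powr g \<le> 4 powr g * r powr g"
            using dy g r by (simp add: powr_mult[symmetric] powr_mono2)
          then have "1 \<le> 4 powr g * r powr g * d y powr (- g)"
            using dy by (simp add: powr_minus field_simps)
          then have "G y * dist x y powr (1 - real ?n) * 1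
              \<le> G y * dist x y powr (1 - real ?n) * (4 powr g * r powr g * d y powr (- g))"
            using G0[of y] by (intro mult_left_mono) auto
          then show ?thesis using True
            by (auto simp: ennreal_mult'[symmetric] f_def mult_ac intro!: ennreal_leI)
        qed auto
      qed
      then show ?thesis by (simp add: J_def nn_integral_cmult)
    qed
    \<comment> \<open>As d(y) <= |y - w|, the integrand is at most f(y) |y - w|^(delta - lam). The
      potential estimate for \<open>N\<close> yields a multiple of r^(g+1-n) m, and r^(1-n) m is
      controlled by \<open>J\<close>.\<close>
    have Iw: "?I w \<le> ennreal (K\<^sub>2 * r powr g) * J"
    proof -
      have "?I w \<le> (\<integral>\<^sup>+y. (ennreal (f y) * indicator B y) *
          (ennreal (dist w y powr (\<delta> - lam)) * indicator (ball w (5 * r)) y) \<partial>lborel)"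
      proof (rule nn_integral_mono)
        fix y
        show "ennreal (G y * dist w y powr (1 - real ?n)) * indicator B y \<le> (ennreal (f y) * indicator B y) *
          (ennreal (dist w y powr (\<delta> - lam)) * indicator (ball w (5 * r)) y)"
        proof (cases "y \<in> B \<and> G y \<noteq> 0")
          case True
          then have "y \<in> \<Omega>" using G_out by blast
          then have dy: "0 < d y" using dist_bd_pos[OF \<Omega>] by (simp add: d_def)
          have dw: "d y \<le> dist w y" using dist_bd_le_dist[OF wf] by (simp add: d_def)
          have "d y powr g \<le> dist w y powr g" using dy dw g by (intro powr_mono2) auto
          then have "1 \<le> d y powr (- g) * dist w y powr g"
            using dy by (simp add: powr_minus field_simps)
          then have "G y * dist w y powr (1 - real ?n) * 1
              \<le> G y * dist w y powr (1 - real ?n) * (d y powr (- g) * dist w y powr g)"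
            using G0[of y] by (intro mult_left_mono) auto
          also have "\<dots> = f y * (dist w y powr g * dist w y powr (1 - real ?n))" by (simp add: f_def)
          also have "\<dots> = f y * dist w y powr (\<delta> - lam)"
            by (subst powr_add[symmetric]) (simp add: \<delta>_def algebra_simps)
          finally have le: "G y * dist w y powr (1 - real ?n) \<le> f y * dist w y powr (\<delta> - lam)" by simp
          have "y \<in> ball w (5 * r)"
            using True wx dist_triangle3[of w y x] by (simp add: B_def)
          then show ?thesis using True le f0[of y]
            by (simp add: ennreal_mult'[symmetric] ennreal_leI)
        qed auto
      qed
      also have "\<dots> = (\<integral>\<^sup>+y. ennreal (dist w y powr (\<delta> - lam)) * indicator (ball w (5 * r)) y \<partial>N)"
        unfolding N_def by (rule nn_integral_density[symmetric]) measurable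
      also have "\<dots> \<le> ennreal (potential_const \<delta> lam * A * (5 * r) powr \<delta>)"
        using r by (intro powr_potential_le[OF N A \<delta>] growth) auto
      also have "potential_const \<delta> lam * A * (5 * r) powr \<delta>
          = K\<^sub>2 * r powr g * ((3 * r) powr (1 - real ?n) * m)"
      proof -
        have e: "r powr \<delta> = r powr g * r powr (1 - real ?n) * r powr lam"
          by (simp add: powr_add[symmetric] \<delta>_def algebra_simps)
        have "3 powr (real ?n - 1) * (3 powr (1 - real ?n)) = (1::real)"
          by (simp add: powr_add[symmetric])
        moreover have "potential_const \<delta> lam * A * (5 * r) powr \<delta>
          = potential_const \<delta> lam * (2 * 5 powr lam / C\<^sub>0) * 5 powr \<delta> * r powr g * (r powr (1 - real ?n) * m)"
          using r by (simp add: A_def powr_mult e field_simps)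
        moreover have "K\<^sub>2 * r powr g * ((3 * r) powr (1 - real ?n) * m)
          = potential_const \<delta> lam * (2 * 5 powr lam / C\<^sub>0) * 5 powr \<delta> * r powr g * (r powr (1 - real ?n) * m)
             * (3 powr (real ?n - 1) * (3 powr (1 - real ?n)))"
          using r by (simp add: K\<^sub>2_def powr_mult)
        ultimately show ?thesis by simp
      qed
      also have "ennreal \<dots> = ennreal (K\<^sub>2 * r powr g) * (ennreal ((3 * r) powr (1 - real ?n)) * emeasure N UNIV)"
        using K2 m by (simp add: ennreal_mult'[symmetric])
      also have "\<dots> \<le> ennreal (K\<^sub>2 * r powr g) * J"
        using mass by (rule mult_left_mono) simp
      finally show ?thesis .
    qed
    define V where "V = unit_ball_vol ?n * (3 * r) ^ ?n"
    have V: "0 < V" using r by (simp add: V_def)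
    define c where "c = (2 * (3 * r)) ^ ?n / real ?n"
    have cV: "c / V = L"
    proof -
      have "(2 * a) ^ ?n / real ?n / (unit_ball_vol ?n * a ^ ?n) = L" if "0 < a" for a :: real
        using that by (simp add: L_def power_mult_distrib field_simps)
      then show ?thesis using r by (simp only: c_def V_def)
    qed
    have "ennreal \<bar>v x\<bar> * ennreal V = (\<integral>\<^sup>+z. ennreal \<bar>v x\<bar> * indicator B z \<partial>lborel)"
      using r by (simp add: nn_integral_cmult_indicator B_def V_def emeasure_ball)
    also have "\<dots> \<le> (\<integral>\<^sup>+z. ennreal \<bar>v z - v x\<bar> * indicator B z + ennreal \<bar>v z - v w\<bar> * indicator B z \<partial>lborel)"
      using v_bd[OF wf] by (intro nn_integral_mono)
        (auto simp: indicator_def ennreal_plus[symmetric] simp del: ennreal_plus intro!: ennreal_leI)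
    also have "\<dots> = (\<integral>\<^sup>+z. ennreal \<bar>v z - v x\<bar> * indicator B z \<partial>lborel)
        + (\<integral>\<^sup>+z. ennreal \<bar>v z - v w\<bar> * indicator B z \<partial>lborel)"
      by (rule nn_integral_add) auto
    also have "\<dots> \<le> ennreal c * ?I x + ennreal c * ?I w"
      unfolding B_def c_def using wB r
      by (intro add_mono mean_oscillation_le_riesz_potential[OF G G0 ug]) (auto simp: B_def)
    also have "\<dots> \<le> ennreal c * (ennreal (4 powr g * r powr g) * J) + ennreal c * (ennreal (K\<^sub>2 * r powr g) * J)"
      by (intro add_mono mult_left_mono Ix Iw) auto
    finally have main: "ennreal \<bar>v x\<bar> * ennreal V
      \<le> ennreal c * (ennreal (4 powr g * r powr g) * J) + ennreal c * (ennreal (K\<^sub>2 * r powr g) * J)" .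
    have c0: "0 \<le> c" using r by (simp add: c_def)
    obtain j where j: "J = ennreal j" "0 \<le> j" using Jfin by (cases J) auto
    have "ennreal (\<bar>v x\<bar> * V) \<le> ennreal (c * (4 powr g + K\<^sub>2) * r powr g * j)"
      using main c0 j K2 V by (simp add: ennreal_mult'[symmetric] ennreal_plus[symmetric] algebra_simps del: ennreal_plus)
    then have "\<bar>v x\<bar> * V \<le> c * (4 powr g + K\<^sub>2) * r powr g * j"
      using c0 j K2 by (subst (asm) ennreal_le_iff) auto
    then have "\<bar>v x\<bar> \<le> (c / V) * (4 powr g + K\<^sub>2) * r powr g * j"
      using V by (simp add: field_simps)
    then have "\<bar>v x\<bar> \<le> K * r powr g * j" by (simp add: cV K_def)
    then have "ennreal \<bar>v x\<bar> \<le> ennreal (K * r powr g) * J"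
      using j K by (simp add: ennreal_mult'[symmetric] ennreal_leI)
    then show ?thesis by (simp only: J r_def)
  qed
  show ?thesis
    by (intro exI[of _ K] conjI allI impI K bound[unfolded d_def]) auto
qed

text \<open>After multiplication by d(x)^(-gamma-1) and exchange of the integrals, fix y. If |x - y|
  < 3 d(x), then d(y) <= 4 d(x), hence |x - y| + d(y) <= 7 d(x), and the decaying kernel estimate
  with t = d(y) gives d(y)^(-eps). Together with d(y)^(-g) this is d(y)^(-gamma).\<close>

lemma weighted_hardy_exponent_one:
  fixes \<Omega> :: "'a::euclidean_space set"
  assumes \<Omega>: "open \<Omega>" "frontier \<Omega> \<noteq> {}" and C0: "0 < C\<^sub>0"
    and dens: "\<forall>x\<in>\<Omega>. ennreal (C\<^sub>0 * dist_bd \<Omega> x powr lam)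
        \<le> hausdorff_content lam (frontier \<Omega> \<inter> ball x (2 * dist_bd \<Omega> x))"
    and lam: "lam \<le> real DIM('a) - 1" and \<gamma>: "real DIM('a) - 1 - lam < \<gamma>"
  shows "\<exists>C>0. \<forall>v G. v \<in> borel_measurable borel \<longrightarrow> segment_gradient v G
      \<longrightarrow> (\<forall>y. y \<notin> \<Omega> \<longrightarrow> G y = 0) \<longrightarrow> (\<forall>y\<in>frontier \<Omega>. v y = 0) \<longrightarrow>
     (\<integral>\<^sup>+x. ennreal (\<bar>v x\<bar> * dist_bd \<Omega> x powr (- \<gamma> - 1)) * indicator \<Omega> x \<partial>lborel)
       \<le> ennreal C * (\<integral>\<^sup>+y. ennreal (G y * dist_bd \<Omega> y powr (- \<gamma>)) * indicator \<Omega> y \<partial>lborel)"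
proof -
  let ?n = "DIM('a)"
  define d where "d = dist_bd \<Omega>"
  have d_meas[measurable]: "d \<in> borel_measurable borel" by (simp add: d_def)
  have [measurable]: "\<Omega> \<in> sets borel" using \<Omega> by simp
  \<comment> \<open>The slack makes the sum over all scales of balls containing a given point converge.\<close>
  define g where "g = (\<gamma> + (real ?n - 1 - lam)) / 2"
  define \<epsilon> where "\<epsilon> = \<gamma> - g"
  have g: "real ?n - 1 - lam < g" "0 \<le> g" and \<epsilon>: "0 < \<epsilon>"
    using \<gamma> lam by (auto simp: g_def \<epsilon>_def field_simps)
  obtain K where K: "0 < K" and pw: "\<And>v G x. v \<in> borel_measurable borel \<Longrightarrow> segment_gradient v G
      \<Longrightarrow> (\<forall>y. y \<notin> \<Omega> \<longrightarrow> G y = 0) \<Longrightarrow> (\<forall>y\<in>frontier \<Omega>. v y = 0) \<Longrightarrow> x \<in> \<Omega> \<Longrightarrow>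
     ennreal \<bar>v x\<bar> \<le> ennreal (K * d x powr g) *
       (\<integral>\<^sup>+y. ennreal (dist x y powr (1 - real ?n) * (G y * d y powr (- g)))
          * indicator (ball x (3 * d x)) y \<partial>lborel)"
    using pointwise_hardy[OF \<Omega> C0 dens g] unfolding d_def by blast
  obtain C' where C': "0 < C'" and kern: "\<And>(y::'a) t. 0 < t \<Longrightarrow>
    (\<integral>\<^sup>+x. ennreal (dist y x powr (1 - real ?n) * (dist y x + t) powr (- 1 - \<epsilon>)) \<partial>lborel)
      \<le> ennreal (C' * t powr (- \<epsilon>))"
    using riesz_kernel_decay_integral_le[OF \<epsilon>] by blast
  define C where "C = K * 7 powr (1 + \<epsilon>) * C'"
  have C: "0 < C" using K C' by (simp add: C_def)
  \<comment> \<open>The weight d(x)^(-gamma-1) times the factor d(x)^g of the pointwise bound is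
    d(x)^(-1-eps). The conditional replaces the indicator of \<open>ball x (3 * d x)\<close> by a
    form whose joint measurability is evident.\<close>
  define k where "k x y = ennreal (dist x y powr (1 - real ?n) * d x powr (- 1 - \<epsilon>)) * indicator \<Omega> x
      * (if dist x y < 3 * d x then 1 else 0)" for x y
  have k_meas[measurable]: "case_prod k \<in> borel_measurable (borel \<Otimes>\<^sub>M borel)"
    unfolding k_def case_prod_unfold by measurable
  have k_int: "(\<integral>\<^sup>+x. k x y \<partial>lborel) \<le> ennreal (7 powr (1 + \<epsilon>) * C' * d y powr (- \<epsilon>))"
    if y: "y \<in> \<Omega>" for y
  proof -
    have dy: "0 < d y" using dist_bd_pos[OF \<Omega> y] by (simp add: d_def)
    have "(\<integral>\<^sup>+x. k x y \<partial>lborel) \<le> (\<integral>\<^sup>+x. ennreal (7 powr (1 + \<epsilon>)) *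
        ennreal (dist y x powr (1 - real ?n) * (dist y x + d y) powr (- 1 - \<epsilon>)) \<partial>lborel)"
    proof (rule nn_integral_mono)
      fix x
      show "k x y \<le> ennreal (7 powr (1 + \<epsilon>)) *
        ennreal (dist y x powr (1 - real ?n) * (dist y x + d y) powr (- 1 - \<epsilon>))"
      proof (cases "x \<in> \<Omega> \<and> dist x y < 3 * d x")
        case True
        then have dx: "0 < d x" using dist_bd_pos[OF \<Omega>] by (simp add: d_def)
        have "dist y x + d y \<le> 7 * d x"
          using dist_bd_le[of \<Omega> y x] True by (simp add: d_def dist_commute)
        then have "(7 * d x) powr (- 1 - \<epsilon>) \<le> (dist y x + d y) powr (- 1 - \<epsilon>)"
          using dy \<epsilon> by (intro powr_mono2') (auto intro: add_nonneg_pos)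
        then have "7 powr (1 + \<epsilon>) * (7 * d x) powr (- 1 - \<epsilon>) \<le> 7 powr (1 + \<epsilon>) * (dist y x + d y) powr (- 1 - \<epsilon>)"
          by (intro mult_left_mono) auto
        moreover have "7 powr (1 + \<epsilon>) * (7 * d x) powr (- 1 - \<epsilon>) = d x powr (- 1 - \<epsilon>)"
        proof -
          have "7 powr (1 + \<epsilon>) * 7 powr (- 1 - \<epsilon>) = (1::real)"
            by (subst powr_add[symmetric]) simp
          then show ?thesis using dx by (simp add: powr_mult)
        qed
        ultimately have "dist x y powr (1 - real ?n) * d x powr (- 1 - \<epsilon>)
            \<le> dist x y powr (1 - real ?n) * (7 powr (1 + \<epsilon>) * (dist y x + d y) powr (- 1 - \<epsilon>))"
          by (intro mult_left_mono) auto
        then show ?thesis using True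
          by (auto simp: k_def ennreal_mult'[symmetric] dist_commute mult_ac intro!: ennreal_leI)
      qed (auto simp: k_def)
    qed
    also have "\<dots> = ennreal (7 powr (1 + \<epsilon>)) *
        (\<integral>\<^sup>+x. ennreal (dist y x powr (1 - real ?n) * (dist y x + d y) powr (- 1 - \<epsilon>)) \<partial>lborel)"
      by (rule nn_integral_cmult) measurable
    also have "\<dots> \<le> ennreal (7 powr (1 + \<epsilon>)) * ennreal (C' * d y powr (- \<epsilon>))"
      by (intro mult_left_mono kern dy) simp
    finally show ?thesis by (simp add: ennreal_mult'[symmetric] mult.assoc)
  qed
  have bound: "(\<integral>\<^sup>+x. ennreal (\<bar>v x\<bar> * d x powr (- \<gamma> - 1)) * indicator \<Omega> x \<partial>lborel)
       \<le> ennreal C * (\<integral>\<^sup>+y. ennreal (G y * d y powr (- \<gamma>)) * indicator \<Omega> y \<partial>lborel)"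
    if v[measurable]: "v \<in> borel_measurable borel" and sg: "segment_gradient v G"
      and G_out: "\<forall>y. y \<notin> \<Omega> \<longrightarrow> G y = 0" and v_bd: "\<forall>y\<in>frontier \<Omega>. v y = 0" for v G
  proof -
    have G[measurable]: "G \<in> borel_measurable borel" and G0: "\<And>y. 0 \<le> G y"
      using sg by (auto simp: segment_gradient_def)
    define f where "f y = G y * d y powr (- g)" for y
    have f0: "0 \<le> f y" for y using G0 by (simp add: f_def)
    have f[measurable]: "f \<in> borel_measurable borel" unfolding f_def by measurable
    have "(\<integral>\<^sup>+x. ennreal (\<bar>v x\<bar> * d x powr (- \<gamma> - 1)) * indicator \<Omega> x \<partial>lborel)
      \<le> (\<integral>\<^sup>+x. (\<integral>\<^sup>+y. ennreal K * (k x y * ennreal (f y)) \<partial>lborel) \<partial>lborel)"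
    proof (rule nn_integral_mono)
      fix x
      show "ennreal (\<bar>v x\<bar> * d x powr (- \<gamma> - 1)) * indicator \<Omega> x
          \<le> (\<integral>\<^sup>+y. ennreal K * (k x y * ennreal (f y)) \<partial>lborel)"
      proof (cases "x \<in> \<Omega>")
        case True
        let ?h = "\<lambda>y. ennreal (dist x y powr (1 - real ?n) * f y) * indicator (ball x (3 * d x)) y"
        have "ennreal (\<bar>v x\<bar> * d x powr (- \<gamma> - 1)) = ennreal (d x powr (- \<gamma> - 1)) * ennreal \<bar>v x\<bar>"
          by (simp add: ennreal_mult'[symmetric] mult.commute)
        also have "\<dots> \<le> ennreal (d x powr (- \<gamma> - 1)) * (ennreal (K * d x powr g) * (\<integral>\<^sup>+y. ?h y \<partial>lborel))"
          using pw[OF v sg G_out v_bd True] unfolding f_def by (rule mult_left_mono) simp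
        also have "\<dots> = ennreal (K * d x powr (- 1 - \<epsilon>)) * (\<integral>\<^sup>+y. ?h y \<partial>lborel)"
        proof -
          have "d x powr (- \<gamma> - 1) * d x powr g = d x powr (- 1 - \<epsilon>)"
            by (subst powr_add[symmetric]) (simp add: \<epsilon>_def algebra_simps)
          then have "d x powr (- \<gamma> - 1) * (K * d x powr g) = K * d x powr (- 1 - \<epsilon>)"
            by (simp add: mult.left_commute)
          then have "ennreal (d x powr (- \<gamma> - 1)) * ennreal (K * d x powr g) = ennreal (K * d x powr (- 1 - \<epsilon>))"
            by (simp only: ennreal_mult'[symmetric, OF powr_ge_zero])
          then show ?thesis by (simp only: mult.assoc[symmetric])
        qed
        also have "\<dots> = (\<integral>\<^sup>+y. ennreal (K * d x powr (- 1 - \<epsilon>)) * ?h y \<partial>lborel)"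
          by (rule nn_integral_cmult[symmetric]) measurable
        also have "\<dots> = (\<integral>\<^sup>+y. ennreal K * (k x y * ennreal (f y)) \<partial>lborel)"
        proof (rule nn_integral_cong)
          fix y
          show "ennreal (K * d x powr (- 1 - \<epsilon>)) * ?h y = ennreal K * (k x y * ennreal (f y))"
            using True K f0[of y]
            by (cases "dist x y < 3 * d x") (simp_all add: k_def ennreal_mult'[symmetric] mult_ac)
        qed
        finally show ?thesis using True by simp
      qed simp
    qed
    also have "\<dots> = (\<integral>\<^sup>+y. (\<integral>\<^sup>+x. ennreal K * (k x y * ennreal (f y)) \<partial>lborel) \<partial>lborel)"
      by (rule lborel_pair.Fubini'[symmetric]) (unfold case_prod_unfold, measurable)
    also have "\<dots> \<le> (\<integral>\<^sup>+y. ennreal C * (ennreal (G y * d y powr (- \<gamma>)) * indicator \<Omega> y) \<partial>lborel)"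
    proof (rule nn_integral_mono)
      fix y
      show "(\<integral>\<^sup>+x. ennreal K * (k x y * ennreal (f y)) \<partial>lborel)
          \<le> ennreal C * (ennreal (G y * d y powr (- \<gamma>)) * indicator \<Omega> y)"
      proof (cases "y \<in> \<Omega>")
        case True
        have "(\<integral>\<^sup>+x. ennreal K * (k x y * ennreal (f y)) \<partial>lborel)
            = (\<integral>\<^sup>+x. ennreal (K * f y) * k x y \<partial>lborel)"
          using K by (intro nn_integral_cong) (simp add: ennreal_mult' mult_ac)
        also have "\<dots> = ennreal (K * f y) * (\<integral>\<^sup>+x. k x y \<partial>lborel)"
          by (rule nn_integral_cmult) measurable
        also have "\<dots> \<le> ennreal (K * f y) * ennreal (7 powr (1 + \<epsilon>) * C' * d y powr (- \<epsilon>))"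
          by (intro mult_left_mono k_int True) simp
        also have "\<dots> = ennreal (C * (G y * d y powr (- \<gamma>)))"
        proof -
          have "d y powr (- g) * d y powr (- \<epsilon>) = d y powr (- \<gamma>)"
            by (subst powr_add[symmetric]) (simp add: \<epsilon>_def)
          then have "C * (G y * d y powr (- \<gamma>)) = K * f y * (7 powr (1 + \<epsilon>) * C' * d y powr (- \<epsilon>))"
            by (simp add: C_def f_def mult_ac)
          then show ?thesis using K f0[of y] by (simp add: ennreal_mult'[symmetric])
        qed
        finally show ?thesis using True C by (simp add: ennreal_mult')
      qed (use G_out in \<open>simp add: f_def\<close>)
    qed
    also have "\<dots> = ennreal C * (\<integral>\<^sup>+y. ennreal (G y * d y powr (- \<gamma>)) * indicator \<Omega> y \<partial>lborel)"
      by (rule nn_integral_cmult) measurable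
    finally show ?thesis .
  qed
  show ?thesis
    by (intro exI[of _ C] conjI allI impI C bound[unfolded d_def]) auto
qed

section \<open>General exponents\<close>

lemma DERIV_abs_powr:
  fixes s p :: real
  assumes "1 < p"
  shows "((\<lambda>s. \<bar>s\<bar> powr p) has_real_derivative p * \<bar>s\<bar> powr (p - 1) * sgn s) (at s)"
proof (cases s "0::real" rule: linorder_cases)
  case less
  have "((\<lambda>s. (- s) powr p) has_real_derivative p * \<bar>s\<bar> powr (p - 1) * sgn s) (at s)"
    using less by (auto intro!: derivative_eq_intros)
  then show ?thesis
    by (rule has_field_derivative_transform_within_open[OF _ open_lessThan[of 0]]) (use less in auto)
next
  case greater
  have "((\<lambda>s. s powr p) has_real_derivative p * \<bar>s\<bar> powr (p - 1) * sgn s) (at s)"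
    using greater by (auto intro!: derivative_eq_intros)
  then show ?thesis
    by (rule has_field_derivative_transform_within_open[OF _ open_greaterThan[of 0]]) (use greater in auto)
next
  case equal
  \<comment> \<open>At the origin the difference quotient has modulus |h|^(p-1), which tends to 0
    because p > 1.\<close>
  have "((\<lambda>h::real. \<bar>h\<bar> powr (p - 1)) \<longlongrightarrow> 0) (at 0)"
    using assms by (intro tendsto_zero_powrI[where b="p - 1"] tendsto_rabs_zero tendsto_ident_at tendsto_const) auto
  then have "((\<lambda>h::real. \<bar>h\<bar> powr p / h) \<longlongrightarrow> 0) (at 0)"
  proof (rule Lim_null_comparison[rotated])
    show "\<forall>\<^sub>F h in at (0::real). norm (\<bar>h\<bar> powr p / h) \<le> \<bar>h\<bar> powr (p - 1)"
      by (auto simp: eventually_at_filter powr_diff)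
  qed
  then show ?thesis using equal by (simp add: DERIV_def)
qed

text \<open>Smoothness is known on the open set \<open>\<Omega>\<close> only. On the open complement
  of the closed support u is locally zero, and these two sets cover the space, so u is continuously
  differentiable everywhere.\<close>

lemma
  fixes u :: "'a::euclidean_space \<Rightarrow> real"
  assumes \<Omega>: "open \<Omega>" and u: "u \<in> test_functions \<Omega>"
  shows test_function_has_derivative: "(u has_derivative (\<lambda>h. grad u x \<bullet> h)) (at x)"
    and test_function_continuous_grad: "continuous_on UNIV (grad u)"
    and test_function_grad_eq_0: "x \<notin> \<Omega> \<Longrightarrow> grad u x = 0"
proof -
  define S where "S = closure {x. u x \<noteq> 0}"
  have S: "closed S" "S \<subseteq> \<Omega>" using u by (auto simp: S_def test_functions_def)
  have smooth: "iter_deriv vs u differentiable_on \<Omega>" for vs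
    using u by (simp add: test_functions_def smooth_on_def)
  have uS: "u y = 0" if "y \<notin> S" for y
    using that closure_subset[of "{x. u x \<noteq> 0}"] unfolding S_def by blast
  have out: "(u has_derivative (\<lambda>_. 0)) (at y)" if "y \<notin> S" for y
  proof (rule has_derivative_transform_within_open[where f="\<lambda>_. 0" and s="- S"])
    show "open (- S)" "y \<in> - S" using that S by auto
  qed (auto simp: uS)
  have fd: "(u has_derivative frechet_derivative u (at y)) (at y)" for y
  proof (cases "y \<in> \<Omega>")
    case True
    then show ?thesis
      using smooth[of "[]"] \<Omega> by (simp add: differentiable_on_eq_differentiable_at frechet_derivative_works)
  next
    case False
    then have "u differentiable at y" using out S by (blast intro: differentiableI)
    then show ?thesis by (simp add: frechet_derivative_works)
  qed
  have fd_eq: "frechet_derivative u (at x) h = grad u x \<bullet> h" for x h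
  proof -
    have "linear (frechet_derivative u (at x))"
      using fd[of x] by (rule has_derivative_linear)
    then have "frechet_derivative u (at x) (\<Sum>b\<in>Basis. (h \<bullet> b) *\<^sub>R b)
        = (\<Sum>b\<in>Basis. (h \<bullet> b) * frechet_derivative u (at x) b)"
      by (simp add: linear_sum linear_cmul)
    then have "frechet_derivative u (at x) h = (\<Sum>b\<in>Basis. (h \<bullet> b) * frechet_derivative u (at x) b)"
      by (simp only: euclidean_representation)
    also have "\<dots> = grad u x \<bullet> h"
      unfolding grad_def inner_sum_left by (intro sum.cong) (simp_all add: inner_commute)
    finally show ?thesis .
  qed
  have "frechet_derivative u (at x) = (\<lambda>h. grad u x \<bullet> h)" for x
    by (rule ext) (rule fd_eq)
  then show "(u has_derivative (\<lambda>h. grad u x \<bullet> h)) (at x)" for x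
    using fd[of x] by (simp only:)
  have fd0: "frechet_derivative u (at y) = (\<lambda>_. 0)" if "y \<notin> S" for y
    using frechet_derivative_at[OF out[OF that]] by simp
  show "grad u x = 0" if "x \<notin> \<Omega>"
  proof -
    have "x \<notin> S" using that S by blast
    then show ?thesis by (simp add: grad_def fd0)
  qed
  have "continuous_on UNIV (\<lambda>y. frechet_derivative u (at y) b)" for b
  proof -
    \<comment> \<open>Smoothness for the one-element list \<open>[b]\<close> makes the partial
      derivative differentiable, hence continuous.\<close>
    have "continuous_on \<Omega> (\<lambda>y. frechet_derivative u (at y) b)"
      using differentiable_imp_continuous_on[OF smooth[of "[b]"]] by simp
    moreover have "continuous_on (- S) (\<lambda>y. frechet_derivative u (at y) b)"
      by (rule continuous_on_eq[OF continuous_on_const[of _ 0]]) (simp add: fd0)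
    ultimately have "continuous_on (\<Omega> \<union> - S) (\<lambda>y. frechet_derivative u (at y) b)"
      using \<Omega> S by (intro continuous_on_open_Un) auto
    moreover have "\<Omega> \<union> - S = UNIV" using S by auto
    ultimately show ?thesis by simp
  qed
  then show "continuous_on UNIV (grad u)"
    unfolding grad_def by (intro continuous_intros) auto
qed

text \<open>The fundamental theorem of calculus for |u|^p along the segment, with the derivative
  bounded by Cauchy-Schwarz.\<close>

lemma segment_gradient_abs_powr:
  fixes u :: "'a::euclidean_space \<Rightarrow> real"
  assumes p: "1 < p" and u: "\<And>x. (u has_derivative (\<lambda>h. D x \<bullet> h)) (at x)"
    and D: "continuous_on UNIV D"
  shows "segment_gradient (\<lambda>x. \<bar>u x\<bar> powr p) (\<lambda>x. p * \<bar>u x\<bar> powr (p - 1) * norm (D x))"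
proof -
  define G where "G x = p * \<bar>u x\<bar> powr (p - 1) * norm (D x)" for x
  have ucont: "continuous_on UNIV u"
    using u by (intro has_derivative_continuous_on) (auto intro: has_derivative_at_withinI)
  have Gcont: "continuous_on UNIV G"
    unfolding G_def using p by (intro continuous_intros continuous_on_powr' ucont D) auto
  have G0: "0 \<le> G x" for x using p by (simp add: G_def)
  have "ennreal \<bar>\<bar>u z\<bar> powr p - \<bar>u w\<bar> powr p\<bar> \<le>
      (\<integral>\<^sup>+t. ennreal (G (w + t *\<^sub>R (z - w)) * norm (z - w)) * indicator {0<..1} t \<partial>lborel)" for z w
  proof -
    let ?l = "\<lambda>t::real. w + t *\<^sub>R (z - w)"
    define \<phi> where "\<phi> t = p * \<bar>u (?l t)\<bar> powr (p - 1) * sgn (u (?l t)) * (D (?l t) \<bullet> (z - w))" for t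
    have "((\<lambda>t. \<bar>u (?l t)\<bar> powr p) has_real_derivative \<phi> t) (at t)" for t
    proof -
      have "((\<lambda>t. u (?l t)) has_derivative (\<lambda>h. D (?l t) \<bullet> (h *\<^sub>R (z - w)))) (at t)"
        by (rule has_derivative_compose[of ?l "\<lambda>h. h *\<^sub>R (z - w)", OF _ u])
          (auto intro!: derivative_eq_intros)
      then have "((\<lambda>t. u (?l t)) has_real_derivative D (?l t) \<bullet> (z - w)) (at t)"
        by (simp add: has_field_derivative_def mult_commute_abs)
      from DERIV_chain2[OF DERIV_abs_powr[OF p] this] show ?thesis by (simp add: \<phi>_def)
    qed
    then have "(\<phi> has_integral (\<bar>u (?l 1)\<bar> powr p - \<bar>u (?l 0)\<bar> powr p)) {0..1}"
      by (intro fundamental_theorem_of_calculus)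
        (auto simp: has_real_derivative_iff_has_vector_derivative[symmetric] intro: DERIV_subset)
    then have \<phi>: "(\<phi> has_integral (\<bar>u z\<bar> powr p - \<bar>u w\<bar> powr p)) {0..1}" by simp
    define \<psi> where "\<psi> t = G (?l t) * norm (z - w)" for t
    have "continuous_on {0..1} \<psi>"
      unfolding \<psi>_def
      by (intro continuous_intros continuous_on_compose2[OF Gcont]) auto
    then have \<psi>: "\<psi> integrable_on {0..1}" by (rule integrable_continuous_interval)
    have le: "norm (\<phi> t) \<le> \<psi> t" for t
    proof -
      have "norm (\<phi> t) = p * \<bar>u (?l t)\<bar> powr (p - 1) * \<bar>sgn (u (?l t))\<bar> * \<bar>D (?l t) \<bullet> (z - w)\<bar>"
        using p by (simp add: \<phi>_def abs_mult)
      also have "\<dots> \<le> p * \<bar>u (?l t)\<bar> powr (p - 1) * 1 * (norm (D (?l t)) * norm (z - w))"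
        using p by (intro mult_mono Cauchy_Schwarz_ineq2) (auto simp: sgn_if)
      finally show ?thesis by (simp add: \<psi>_def G_def mult_ac)
    qed
    have "norm (integral {0..1} \<phi>) \<le> integral {0..1} \<psi>"
      using \<phi> \<psi> le by (intro integral_norm_bound_integral) auto
    then have "ennreal \<bar>\<bar>u z\<bar> powr p - \<bar>u w\<bar> powr p\<bar> \<le> ennreal (integral {0..1} \<psi>)"
      using integral_unique[OF \<phi>] by (simp add: ennreal_leI)
    also have "\<dots> = (\<integral>\<^sup>+t. indicator {0..1} t * \<psi> t \<partial>lborel)"
      using G0 by (intro nn_integral_has_integral_lebesgue[symmetric] integrable_integral[OF \<psi>])
        (auto simp: \<psi>_def)
    \<comment> \<open>The two intervals differ by the null set t = 0.\<close>
    also have "\<dots> = (\<integral>\<^sup>+t. ennreal (\<psi> t) * indicator {0<..1} t \<partial>lborel)"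
      using AE_lborel_singleton[of "0::real"]
      by (intro nn_integral_cong_AE, eventually_elim) (auto simp: indicator_def)
    finally show ?thesis by (simp add: \<psi>_def)
  qed
  then show ?thesis
    using G0 borel_measurable_continuous_onI[OF Gcont]
    unfolding segment_gradient_def G_def[symmetric] by (simp add: G_def[abs_def])
qed

text \<open>A form of Young's inequality in which one term alone suffices: the first if b <= eta a,
  the second otherwise. The small coefficient stands at the term to be absorbed.\<close>

lemma powr_mult_le_weighted:
  fixes a b \<eta> p :: real
  assumes "0 \<le> a" "0 \<le> b" "0 < \<eta>" "1 < p"
  shows "a powr (p - 1) * b \<le> \<eta> * a powr p + \<eta> powr (1 - p) * b powr p"
proof (cases "b \<le> \<eta> * a")
  case True
  have "a powr (p - 1) * b \<le> a powr (p - 1) * (\<eta> * a)" using True by (intro mult_left_mono) auto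
  also have "\<dots> = \<eta> * a powr p" using assms by (cases "a = 0") (auto simp: powr_diff)
  finally show ?thesis by (simp add: add_increasing2)
next
  case False
  have "0 \<le> \<eta> * a" using assms by simp
  then have b: "0 < b" using False by linarith
  have "a powr (p - 1) \<le> (b / \<eta>) powr (p - 1)"
    using False assms by (intro powr_mono2) (auto simp: field_simps)
  then have "a powr (p - 1) * b \<le> (b / \<eta>) powr (p - 1) * b" using b by (intro mult_right_mono) auto
  also have "\<dots> = \<eta> powr (1 - p) * b powr p"
    using assms b by (simp add: powr_divide powr_diff field_simps)
  finally show ?thesis using assms by (simp add: add_increasing)
qed

text \<open>On the compact support d is positive and the integrand continuous, hence bounded.
  Finiteness is what permits the later absorption.\<close>

lemma test_function_weighted_integral_finite:
  fixes u :: "'a::euclidean_space \<Rightarrow> real"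
  assumes \<Omega>: "open \<Omega>" "frontier \<Omega> \<noteq> {}" and u: "u \<in> test_functions \<Omega>" and p: "0 < p"
    and cont: "continuous_on UNIV u"
  shows "(\<integral>\<^sup>+x. ennreal (\<bar>u x\<bar> powr p * dist_bd \<Omega> x powr a) * indicator \<Omega> x \<partial>lborel) < \<infinity>"
proof -
  define S where "S = closure {x. u x \<noteq> 0}"
  have S: "compact S" "S \<subseteq> \<Omega>" using u by (auto simp: S_def test_functions_def)
  have uS: "u y = 0" if "y \<notin> S" for y
    using that closure_subset[of "{x. u x \<noteq> 0}"] unfolding S_def by blast
  have "continuous_on S (\<lambda>x. \<bar>u x\<bar> powr p * dist_bd \<Omega> x powr a)"
  proof (rule continuous_on_mult)
    have "continuous_on S u" using cont by (rule continuous_on_subset) simp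
    then show "continuous_on S (\<lambda>x. \<bar>u x\<bar> powr p)"
      using p by (intro continuous_on_powr' continuous_on_rabs continuous_on_const) auto
    have "0 < dist_bd \<Omega> x" if "x \<in> S" for x
      using that S(2) dist_bd_pos[OF \<Omega>] by blast
    then show "continuous_on S (\<lambda>x. dist_bd \<Omega> x powr a)"
      by (intro continuous_on_powr continuous_on_dist_bd continuous_on_const) (metis less_irrefl)
  qed
  then have "compact ((\<lambda>x. \<bar>u x\<bar> powr p * dist_bd \<Omega> x powr a) ` S)"
    using S by (intro compact_continuous_image)
  then obtain M where M: "\<And>x. x \<in> S \<Longrightarrow> \<bar>u x\<bar> powr p * dist_bd \<Omega> x powr a \<le> M"
    using compact_imp_bounded bounded_imp_bdd_above by (metis (no_types, lifting) bdd_above.E imageI)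
  have "(\<integral>\<^sup>+x. ennreal (\<bar>u x\<bar> powr p * dist_bd \<Omega> x powr a) * indicator \<Omega> x \<partial>lborel)
     \<le> (\<integral>\<^sup>+x. ennreal M * indicator S x \<partial>lborel)"
  proof (rule nn_integral_mono)
    fix x
    show "ennreal (\<bar>u x\<bar> powr p * dist_bd \<Omega> x powr a) * indicator \<Omega> x \<le> ennreal M * indicator S x"
      using M[of x] uS[of x] S(2) by (cases "x \<in> S") (auto intro!: ennreal_leI)
  qed
  also have "\<dots> = ennreal M * emeasure lborel S"
    using S by (intro nn_integral_cmult_indicator) (simp add: borel_compact)
  also have "\<dots> < \<infinity>"
    using emeasure_compact_finite[OF S(1)] by (simp add: ennreal_mult_less_top)
  finally show ?thesis .
qed

section \<open>Absorption and the inequality for general exponents\<close>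

theorem theorem1p2:
  fixes \<Omega> :: "'a::euclidean_space set"
    and p lam C\<^sub>0 :: real
  assumes "open \<Omega>" and "\<Omega> \<noteq> UNIV"
    and "1 < p"
    and "0 \<le> lam" and "lam \<le> real DIM('a) - 1"
    and "C\<^sub>0 > 0"
    and "\<forall>x\<in>\<Omega>. hausdorff_content lam (frontier \<Omega> \<inter> ball x (2 * dist_bd \<Omega> x))
                  \<ge> ennreal (C\<^sub>0 * dist_bd \<Omega> x powr lam)"
  shows "\<forall>\<beta>::real. \<beta> < p - real DIM('a) + lam \<longrightarrow>
           (\<exists>C>0. \<forall>u\<in>test_functions \<Omega>.
              (\<integral>\<^sup>+x\<in>\<Omega>. ennreal (\<bar>u x\<bar> powr p * dist_bd \<Omega> x powr (\<beta> - p)) \<partial>lebesgue)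
              \<le> ennreal C * (\<integral>\<^sup>+x\<in>\<Omega>. ennreal (norm (grad u x) powr p * dist_bd \<Omega> x powr \<beta>) \<partial>lebesgue))"
proof (cases "\<Omega> = {}")
  case True
  then show ?thesis by (auto intro!: exI[of _ 1])
next
  case False
  \<comment> \<open>A set that is neither empty nor the whole connected space has boundary
    points.\<close>
  then have fr: "frontier \<Omega> \<noteq> {}" using assms(2) by (simp add: frontier_eq_empty)
  note p = \<open>1 < p\<close>
  define d where "d = dist_bd \<Omega>"
  have d_meas[measurable]: "d \<in> borel_measurable borel" by (simp add: d_def)
  have [measurable]: "\<Omega> \<in> sets borel" using \<open>open \<Omega>\<close> by simp
  show ?thesis
  proof (intro allI impI)
    fix \<beta> :: real
    assume \<beta>: "\<beta> < p - real DIM('a) + lam"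
    define \<gamma> where "\<gamma> = p - 1 - \<beta>"
    have \<gamma>: "real DIM('a) - 1 - lam < \<gamma>" using \<beta> by (simp add: \<gamma>_def)
    obtain C where C: "0 < C" and hardy1: "\<And>v G. v \<in> borel_measurable borel \<Longrightarrow> segment_gradient v G
      \<Longrightarrow> (\<forall>y. y \<notin> \<Omega> \<longrightarrow> G y = 0) \<Longrightarrow> (\<forall>y\<in>frontier \<Omega>. v y = 0) \<Longrightarrow>
       (\<integral>\<^sup>+x. ennreal (\<bar>v x\<bar> * d x powr (- \<gamma> - 1)) * indicator \<Omega> x \<partial>lborel)
       \<le> ennreal C * (\<integral>\<^sup>+y. ennreal (G y * d y powr (- \<gamma>)) * indicator \<Omega> y \<partial>lborel)"
      using weighted_hardy_exponent_one[OF assms(1) fr assms(6,7,5) \<gamma>] unfolding d_def by blast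
    \<comment> \<open>Chosen so that C p eta = 1/2, the share of the left-hand side to be
      absorbed.\<close>
    define \<eta> where "\<eta> = 1 / (2 * C * p)"
    have \<eta>: "0 < \<eta>" using C p by (simp add: \<eta>_def)
    define M where "M = C * p * \<eta> powr (1 - p)"
    have M: "0 < M" using C p \<eta> by (simp add: M_def)
    have "(\<integral>\<^sup>+x. ennreal (\<bar>u x\<bar> powr p * d x powr (\<beta> - p)) * indicator \<Omega> x \<partial>lborel)
      \<le> ennreal (2 * M) * (\<integral>\<^sup>+x. ennreal (norm (grad u x) powr p * d x powr \<beta>) * indicator \<Omega> x \<partial>lborel)"
      (is "?A \<le> _ * ?B") if u: "u \<in> test_functions \<Omega>" for u
    proof -
      note der = test_function_has_derivative[OF assms(1) u]
      note gcont = test_function_continuous_grad[OF assms(1) u]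
      have ucont: "continuous_on UNIV u"
        using der by (intro has_derivative_continuous_on) (auto intro: has_derivative_at_withinI)
      have [measurable]: "u \<in> borel_measurable borel" "grad u \<in> borel_measurable borel"
        using ucont gcont by (auto intro: borel_measurable_continuous_onI)
      have u0: "u y = 0" if "y \<notin> \<Omega>" for y
        using that u closure_subset[of "{x. u x \<noteq> 0}"] by (auto simp: test_functions_def)
      define G where "G x = p * \<bar>u x\<bar> powr (p - 1) * norm (grad u x)" for x
      have "?A = (\<integral>\<^sup>+x. ennreal (\<bar>\<bar>u x\<bar> powr p\<bar> * d x powr (- \<gamma> - 1)) * indicator \<Omega> x \<partial>lborel)"
        by (simp add: \<gamma>_def algebra_simps)
      also have "\<dots> \<le> ennreal C * (\<integral>\<^sup>+x. ennreal (G x * d x powr (- \<gamma>)) * indicator \<Omega> x \<partial>lborel)"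
      proof (rule hardy1)
        show "segment_gradient (\<lambda>x. \<bar>u x\<bar> powr p) G"
          unfolding G_def by (rule segment_gradient_abs_powr[OF p der gcont])
        show "\<forall>y. y \<notin> \<Omega> \<longrightarrow> G y = 0" by (simp add: G_def u0)
        show "\<forall>y\<in>frontier \<Omega>. \<bar>u y\<bar> powr p = 0"
          using u0 assms(1) by (auto simp: frontier_def interior_open)
      qed measurable
      also have "\<dots> = (\<integral>\<^sup>+x. ennreal C * (ennreal (G x * d x powr (- \<gamma>)) * indicator \<Omega> x) \<partial>lborel)"
        unfolding G_def by (rule nn_integral_cmult[symmetric]) measurable
      also have "\<dots> \<le> (\<integral>\<^sup>+x. ennreal (1/2) * (ennreal (\<bar>u x\<bar> powr p * d x powr (\<beta> - p)) * indicator \<Omega> x)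
          + ennreal M * (ennreal (norm (grad u x) powr p * d x powr \<beta>) * indicator \<Omega> x) \<partial>lborel)"
      proof (rule nn_integral_mono)
        fix x
        show "ennreal C * (ennreal (G x * d x powr (- \<gamma>)) * indicator \<Omega> x)
          \<le> ennreal (1/2) * (ennreal (\<bar>u x\<bar> powr p * d x powr (\<beta> - p)) * indicator \<Omega> x)
          + ennreal M * (ennreal (norm (grad u x) powr p * d x powr \<beta>) * indicator \<Omega> x)"
        proof (cases "x \<in> \<Omega>")
          case True
          then have dx: "0 < d x" using dist_bd_pos[OF assms(1) fr] by (simp add: d_def)
          \<comment> \<open>With a = |u|/d and the factor d^beta, the two terms of Young's
            inequality carry the weights d^(beta-p) and d^beta, and the product carries d^(beta-p+1)
            = d^(-gamma).\<close>
          let ?a = "\<bar>u x\<bar> / d x" and ?b = "norm (grad u x)"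
          have "?a powr (p - 1) * ?b \<le> \<eta> * ?a powr p + \<eta> powr (1 - p) * ?b powr p"
            using dx \<eta> p by (intro powr_mult_le_weighted) auto
          then have "C * p * d x powr \<beta> * (?a powr (p - 1) * ?b)
              \<le> C * p * d x powr \<beta> * (\<eta> * ?a powr p + \<eta> powr (1 - p) * ?b powr p)"
            using C p by (intro mult_left_mono) auto
          moreover have "C * p * d x powr \<beta> * (?a powr (p - 1) * ?b) = C * (G x * d x powr (- \<gamma>))"
            using dx by (simp add: G_def \<gamma>_def powr_divide powr_diff powr_minus powr_add field_simps)
          moreover have "C * p * d x powr \<beta> * (\<eta> * ?a powr p + \<eta> powr (1 - p) * ?b powr p)
              = 1/2 * (\<bar>u x\<bar> powr p * d x powr (\<beta> - p)) + M * (?b powr p * d x powr \<beta>)"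
          proof -
            have "C * p * \<eta> = 1/2" using C p by (simp add: \<eta>_def)
            moreover have "?a powr p * d x powr \<beta> = \<bar>u x\<bar> powr p * d x powr (\<beta> - p)"
              using dx by (simp add: powr_divide powr_diff)
            moreover have "C * p * d x powr \<beta> * (\<eta> * ?a powr p) = (C * p * \<eta>) * (?a powr p * d x powr \<beta>)"
              by simp
            ultimately have "C * p * d x powr \<beta> * (\<eta> * ?a powr p) = 1/2 * (\<bar>u x\<bar> powr p * d x powr (\<beta> - p))"
              by (simp only:)
            then show ?thesis by (simp add: M_def algebra_simps)
          qed
          ultimately have le: "C * (G x * d x powr (- \<gamma>))
              \<le> 1/2 * (\<bar>u x\<bar> powr p * d x powr (\<beta> - p)) + M * (?b powr p * d x powr \<beta>)" by simp
          have "ennreal C * ennreal (G x * d x powr (- \<gamma>)) = ennreal (C * (G x * d x powr (- \<gamma>)))"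
            using C by (simp add: ennreal_mult')
          also have "\<dots> \<le> ennreal (1/2 * (\<bar>u x\<bar> powr p * d x powr (\<beta> - p)) + M * (?b powr p * d x powr \<beta>))"
            by (rule ennreal_leI[OF le])
          also have "\<dots> = ennreal (1/2) * ennreal (\<bar>u x\<bar> powr p * d x powr (\<beta> - p))
              + ennreal M * ennreal (?b powr p * d x powr \<beta>)"
            using M by (subst ennreal_plus) (simp_all only: ennreal_mult' zero_le_mult_iff powr_ge_zero, auto)
          finally show ?thesis using True by simp
        qed simp
      qed
      also have "\<dots> = ennreal (1/2) * ?A + ennreal M * ?B"
        by (subst nn_integral_add, measurable, subst nn_integral_cmult, measurable, subst nn_integral_cmult, measurable)
      finally have le: "?A \<le> ennreal (1/2) * ?A + ennreal M * ?B" .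
      \<comment> \<open>Only a finite left-hand side can have half of itself subtracted; this turns
        the constant \<open>M\<close> into \<open>2 * M\<close>.\<close>
      have "?A < \<infinity>"
        unfolding d_def using p by (intro test_function_weighted_integral_finite[OF assms(1) fr u _ ucont]) simp
      then obtain A where A: "?A = ennreal A" "0 \<le> A" by (cases ?A) auto
      show ?thesis
      proof (cases ?B)
        case (real B)
        have "ennreal A \<le> ennreal (1/2) * ennreal A + ennreal M * ennreal B"
          using le unfolding A real .
        also have "\<dots> = ennreal (1/2 * A + M * B)"
        proof (subst ennreal_plus)
          show "ennreal (1/2) * ennreal A + ennreal M * ennreal B = ennreal (1/2 * A) + ennreal (M * B)"
            using M by (simp only: ennreal_mult'[OF less_imp_le] ennreal_mult'[of "1/2"])
        qed (use A(2) real(1) M in auto)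
        finally have "ennreal A \<le> ennreal (1/2 * A + M * B)" .
        then have "A \<le> 1/2 * A + M * B" using A real M by (subst (asm) ennreal_le_iff) auto
        then show ?thesis unfolding A real using M by (simp add: ennreal_mult'[symmetric] ennreal_leI)
      next
        case top
        then show ?thesis using M by (simp add: ennreal_mult_top)
      qed
    qed
    then show "\<exists>C>0. \<forall>u\<in>test_functions \<Omega>.
              (\<integral>\<^sup>+x\<in>\<Omega>. ennreal (\<bar>u x\<bar> powr p * dist_bd \<Omega> x powr (\<beta> - p)) \<partial>lebesgue)
              \<le> ennreal C * (\<integral>\<^sup>+x\<in>\<Omega>. ennreal (norm (grad u x) powr p * dist_bd \<Omega> x powr \<beta>) \<partial>lebesgue)"
      using M by (intro exI[of _ "2 * M"]) (simp add: nn_integral_completion d_def)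
  qed
qed

end
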